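(* Let $\mathcal T_p$ be a cluster tree of depth $p$ for $n$ and let $A\in\mathbb C^{n\times n}$ be an $\epsilon$-$(\mathcal T_p,k)$-HSS matrix. Then there exists $\delta A\in\mathbb C^{n\times n}$ with $\|\delta A\|_2\le\sqrt{2^{p+2}-4}\,\epsilon$ such that $A+\delta A$ is a $(\mathcal T_p,k)$-HSS matrix.
   Context: Cluster tree associated with a partition $n=n_1+\dots+n_{2^p}$ into positive integers: the leaves $I^p_1,\dots,I^p_{2^p}$ are the consecutive index intervals of $I=\{1,\dots,n\}$ of sizes $n_1,\dots,n_{2^p}$ in order, and $I^\ell_i:=I^{\ell+1}_{2i-1}\cup I^{\ell+1}_{2i}$ for $\ell<p$, $i=1,\dots,2^\ell$. For $\ell=1,\dots,p$ and $i=1,\dots,2^\ell$, $A(I^\ell_i,I\setminus I^\ell_i)$ is an HSS block row and $A(I\setminus I^\ell_i,I^\ell_i)$ an HSS block column. $A$ is a $(\mathcal T_p,k)$-HSS matrix if every HSS block row and column has rank at most $k$, and an $\epsilon$-$(\mathcal T_p,k)$-HSS matrix if every HSS block row and column $Y$ admits a matrix $Z$ of rank at most $k$ with $\|Y-Z\|_2\le\epsilon$ (spectral norm). For $p=0$ there are no HSS block rows or columns. *)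

theory Defs
  imports Complex_Main "Jordan_Normal_Form.DL_Rank_Submatrix"
begin

text \<open>Matrices are Jordan_Normal_Form matrices; row/column indices are 0-based,
  so the index set I = {1..n} of the paper is {0..<n} here.\<close>

definition vnorm2 :: "complex vec \<Rightarrow> real" where
  "vnorm2 v = sqrt (\<Sum>i<dim_vec v. (cmod (v $ i))\<^sup>2)"

definition spec_norm :: "complex mat \<Rightarrow> real" where
  "spec_norm M = Sup {vnorm2 (M *\<^sub>v x) | x. x \<in> carrier_vec (dim_col M) \<and> vnorm2 x \<le> 1}"

definition mrank :: "complex mat \<Rightarrow> nat" where
  "mrank M = vec_space.rank (dim_row M) M"

text \<open>Leaf i (1-based, i = 1..2^p) of the cluster tree for the partition ns:
  the i-th consecutive index interval, of size ns!(i-1).\<close>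
definition leaf :: "nat list \<Rightarrow> nat \<Rightarrow> nat set" where
  "leaf ns i = {sum_list (take (i - 1) ns) ..< sum_list (take i ns)}"

text \<open>cnode ns d i is the node I^{p-d}_i: a node d levels above the leaves,
  defined by I^l_i = I^{l+1}_{2i-1} \<union> I^{l+1}_{2i}.\<close>
fun cnode :: "nat list \<Rightarrow> nat \<Rightarrow> nat \<Rightarrow> nat set" where
  "cnode ns 0 i = leaf ns i"
| "cnode ns (Suc d) i = cnode ns d (2 * i - 1) \<union> cnode ns d (2 * i)"

definition cluster :: "nat list \<Rightarrow> nat \<Rightarrow> nat \<Rightarrow> nat \<Rightarrow> nat set" where
  "cluster ns p l i = cnode ns (p - l) i"

definition hss_row :: "complex mat \<Rightarrow> nat list \<Rightarrow> nat \<Rightarrow> nat \<Rightarrow> nat \<Rightarrow> complex mat" where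
  "hss_row A ns p l i = submatrix A (cluster ns p l i) ({0..<dim_row A} - cluster ns p l i)"

definition hss_col :: "complex mat \<Rightarrow> nat list \<Rightarrow> nat \<Rightarrow> nat \<Rightarrow> nat \<Rightarrow> complex mat" where
  "hss_col A ns p l i = submatrix A ({0..<dim_row A} - cluster ns p l i) (cluster ns p l i)"

definition hss_blocks :: "complex mat \<Rightarrow> nat list \<Rightarrow> nat \<Rightarrow> complex mat set" where
  "hss_blocks A ns p = {hss_row A ns p l i | l i. 1 \<le> l \<and> l \<le> p \<and> 1 \<le> i \<and> i \<le> 2 ^ l}
                     \<union> {hss_col A ns p l i | l i. 1 \<le> l \<and> l \<le> p \<and> 1 \<le> i \<and> i \<le> 2 ^ l}"

definition is_HSS :: "nat list \<Rightarrow> nat \<Rightarrow> nat \<Rightarrow> complex mat \<Rightarrow> bool" where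
  "is_HSS ns p k A \<longleftrightarrow> (\<forall>Y \<in> hss_blocks A ns p. mrank Y \<le> k)"

definition is_eps_HSS :: "real \<Rightarrow> nat list \<Rightarrow> nat \<Rightarrow> nat \<Rightarrow> complex mat \<Rightarrow> bool" where
  "is_eps_HSS eps ns p k A \<longleftrightarrow> (\<forall>Y \<in> hss_blocks A ns p.
     \<exists>Z \<in> carrier_mat (dim_row Y) (dim_col Y). mrank Z \<le> k \<and> spec_norm (Y - Z) \<le> eps)"

end

theory Submission
  imports Defs "HOL-Library.Function_Algebras" "HOL-Analysis.L2_Norm"
begin

text \<open>Compress A from the leaves upwards. At a level, let X be the part of the current matrix off
  the diagonal blocks, and replace X by U X V, where U and V are the orthogonal projections onto
  the sums of the column and row spaces of low rank approximants of the block rows and block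
  columns, chosen inside the ranges of the projections of the level below. The errors
  X - U X and U (X - X V), and all errors of the coarser levels, are mutually
  orthogonal either on the left or on the right, so the squares of their norms add up; each block
  row or column contributes at most eps^2, and there are 2^(p+2) - 4 of them. Because the
  ranges are nested, compressing a coarse level keeps the ranks already achieved below it.\<close>

section \<open>Matrices as kernels on the natural numbers\<close>

text \<open>An entry of \<open>A\<close> lies in a block row and a block column at every level that
  separates its two indices, so truncating blocks one by one would let one repair raise the rank of
  another block. Block diagonal projections avoid this: each side treats all blocks of a level at
  once and commutes with cutting out blocks, so the coarser levels still see \<open>A\<close>
  between two projections. No singular value decomposition is involved. If \<open>Z\<close> is any
  approximant of \<open>Y\<close> of rank at most \<open>k\<close> and \<open>\<pi>\<close> projects
  orthogonally onto the columns of \<open>Z\<close>, then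
  \<open>Y - \<pi> Y = (1 - \<pi>) (Y - Z)\<close>, which is no larger than \<open>Y - Z\<close>.
  After earlier compressions the block is \<open>U Y V\<close>, and \<open>U Z V\<close>
  approximates it with at most the same error. Blocks are kept as square arrays with zeros outside
  the block, so that blocks of different shapes can be added and multiplied.\<close>

type_synonym kernel = "nat \<Rightarrow> nat \<Rightarrow> complex"

definition kapp :: "nat \<Rightarrow> kernel \<Rightarrow> (nat \<Rightarrow> complex) \<Rightarrow> nat \<Rightarrow> complex" where
  "kapp n f x = (\<lambda>i. \<Sum>j<n. f i j * x j)"

text \<open>Only the summed index is bounded, by a parameter: the same product serves for operators
  (\<open>n\<close>) and for factorizations of inner dimension \<open>k\<close>, and it is
  associative without shape conditions.\<close>

definition kmul :: "nat \<Rightarrow> kernel \<Rightarrow> kernel \<Rightarrow> kernel" where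
  "kmul n f g = (\<lambda>i j. \<Sum>l<n. f i l * g l j)"

definition kadj :: "kernel \<Rightarrow> kernel" where
  "kadj f = (\<lambda>i j. cnj (f j i))"

definition rmask :: "nat set \<Rightarrow> kernel \<Rightarrow> kernel" where
  "rmask S f = (\<lambda>i j. if i \<in> S then f i j else 0)"

definition cmask :: "nat set \<Rightarrow> kernel \<Rightarrow> kernel" where
  "cmask S f = (\<lambda>i j. if j \<in> S then f i j else 0)"

definition nsq :: "nat \<Rightarrow> (nat \<Rightarrow> complex) \<Rightarrow> real" where
  "nsq n x = (\<Sum>i<n. (cmod (x i))\<^sup>2)"

definition inn :: "nat \<Rightarrow> (nat \<Rightarrow> complex) \<Rightarrow> (nat \<Rightarrow> complex) \<Rightarrow> complex" where
  "inn n x y = (\<Sum>i<n. x i * cnj (y i))"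

text \<open>The constant bounds the square of the operator norm.\<close>
definition opbound :: "nat \<Rightarrow> real \<Rightarrow> kernel \<Rightarrow> bool" where
  "opbound n c f \<longleftrightarrow> (\<forall>x. nsq n (kapp n f x) \<le> c * nsq n x)"

text \<open>Phrased as a factorization of inner dimension \<open>k\<close>, the rank bound passes to
  products, masks and adjoints without dimension theory.\<close>

definition rank_le :: "nat \<Rightarrow> kernel \<Rightarrow> bool" where
  "rank_le k f \<longleftrightarrow> (\<exists>B C. f = kmul k B C)"

definition orthproj :: "nat \<Rightarrow> kernel \<Rightarrow> bool" where
  "orthproj n U \<longleftrightarrow> kadj U = U \<and> kmul n U U = U"

section \<open>Algebra of products, adjoints and masks\<close>

lemma kmul_assoc: "kmul m (kmul n f g) h = kmul n f (kmul m g h)"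
proof (intro ext)
  fix i j
  have "kmul m (kmul n f g) h i j = (\<Sum>l<m. \<Sum>q<n. f i q * g q l * h l j)"
    by (simp add: kmul_def sum_distrib_right)
  also have "\<dots> = (\<Sum>q<n. \<Sum>l<m. f i q * g q l * h l j)"
    by (rule sum.swap)
  also have "\<dots> = kmul n f (kmul m g h) i j"
    by (simp add: kmul_def sum_distrib_left mult.assoc)
  finally show "kmul m (kmul n f g) h i j = kmul n f (kmul m g h) i j" .
qed

lemma kmul_distribs:
  "kmul n (f + g) h = kmul n f h + kmul n g h"
  "kmul n h (f + g) = kmul n h f + kmul n h g"
  "kmul n (f - g) h = kmul n f h - kmul n g h"
  "kmul n h (f - g) = kmul n h f - kmul n h g"
  by (auto simp: kmul_def fun_eq_iff algebra_simps sum.distrib sum_subtractf)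

lemma kmul_zero [simp]: "kmul n 0 h = 0" "kmul n h 0 = 0"
  by (auto simp: kmul_def fun_eq_iff)

lemma sum_kernel_apply: "(\<Sum>s\<in>P. f s) i j = (\<Sum>s\<in>P. (f s i j :: complex))"
  by (induction P rule: infinite_finite_induct) auto

lemma kmul_sum:
  "kmul n (\<Sum>s\<in>P. f s) h = (\<Sum>s\<in>P. kmul n (f s) h)"
  "kmul n h (\<Sum>s\<in>P. f s) = (\<Sum>s\<in>P. kmul n h (f s))"
  by (induction P rule: infinite_finite_induct) (auto simp: kmul_distribs)

lemma kadj_simps [simp]:
  "kadj (kadj f) = f" "kadj (kmul n f g) = kmul n (kadj g) (kadj f)"
  "kadj (f + g) = kadj f + kadj g" "kadj (f - g) = kadj f - kadj g" "kadj 0 = 0"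
  "kadj (rmask S f) = cmask S (kadj f)" "kadj (cmask S f) = rmask S (kadj f)"
  by (auto simp: kadj_def kmul_def fun_eq_iff mult.commute rmask_def cmask_def)

lemma kadj_sum: "kadj (\<Sum>s\<in>P. f s) = (\<Sum>s\<in>P. kadj (f s))"
  by (simp add: fun_eq_iff kadj_def sum_kernel_apply)

lemma kadj_eqD: "kadj f = kadj g \<Longrightarrow> f = g"
  by (metis kadj_simps(1))

lemma mask_kmul:
  "rmask S (kmul n f g) = kmul n (rmask S f) g"
  "cmask S (kmul n f g) = kmul n f (cmask S g)"
  by (auto simp: rmask_def cmask_def kmul_def fun_eq_iff)

lemma kmul_rmask: "kmul n f (rmask S g) = kmul n (cmask S f) g"
  by (auto simp: rmask_def cmask_def kmul_def fun_eq_iff intro!: sum.cong)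

lemma mask_distribs:
  "rmask S (f + g) = rmask S f + rmask S g" "rmask S (f - g) = rmask S f - rmask S g"
  "cmask S (f + g) = cmask S f + cmask S g" "cmask S (f - g) = cmask S f - cmask S g"
  by (auto simp: rmask_def cmask_def fun_eq_iff)

lemma mask_idem [simp]: "rmask S (rmask S f) = rmask S f" "cmask S (cmask S f) = cmask S f"
  by (auto simp: rmask_def cmask_def fun_eq_iff)

lemma rmask_cmask: "rmask S (cmask T f) = cmask T (rmask S f)"
  by (auto simp: rmask_def cmask_def fun_eq_iff)

section \<open>Action on vectors, inner product and Euclidean norm\<close>

lemma kapp_simps:
  "kapp n (f + g) x = kapp n f x + kapp n g x"
  "kapp n (f - g) x = kapp n f x - kapp n g x"
  "kapp n 0 x = 0"
  by (auto simp: kapp_def fun_eq_iff algebra_simps sum.distrib sum_subtractf)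

lemma kapp_kmul: "kapp n (kmul m f g) x = kapp m f (kapp n g x)"
proof -
  \<comment> \<open>The vector \<open>x\<close> becomes a kernel with equal columns; associativity,
    read off in column \<open>0\<close>, gives the claim.\<close>
  have "kmul n (kmul m f g) (\<lambda>i j. x i) i 0 = kmul m f (kmul n g (\<lambda>i j. x i)) i 0" for i
    by (simp add: kmul_assoc)
  then show ?thesis by (auto simp: kapp_def kmul_def)
qed

lemma inn_kapp: "inn n (kapp n f x) y = inn n x (kapp n (kadj f) y)"
proof -
  have "inn n (kapp n f x) y = (\<Sum>i<n. \<Sum>j<n. f i j * x j * cnj (y i))"
    by (simp add: inn_def kapp_def sum_distrib_right)
  also have "\<dots> = (\<Sum>j<n. \<Sum>i<n. f i j * x j * cnj (y i))"
    by (rule sum.swap)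
  also have "\<dots> = inn n x (kapp n (kadj f) y)"
    by (simp add: inn_def kapp_def kadj_def sum_distrib_left algebra_simps)
  finally show ?thesis .
qed

lemma inn_self: "inn n x x = of_real (nsq n x)"
  by (simp add: inn_def nsq_def complex_norm_square[symmetric])

lemma nsq_nonneg [simp]: "0 \<le> nsq n x"
  by (simp add: nsq_def sum_nonneg)

lemma inn_zero [simp]: "inn n 0 y = 0" "inn n x 0 = 0"
  by (auto simp: inn_def)

lemma nsq_add_orthogonal:
  assumes "inn n x y = 0"
  shows "nsq n (x + y) = nsq n x + nsq n y"
proof -
  have "inn n y x = cnj (inn n x y)"
    by (simp add: inn_def mult.commute)
  moreover have "inn n (x + y) (x + y) = inn n x x + inn n x y + inn n y x + inn n y y"
    by (simp add: inn_def algebra_simps sum.distrib)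
  ultimately have "complex_of_real (nsq n (x + y)) = of_real (nsq n x + nsq n y)"
    using assms by (simp add: inn_self)
  then show ?thesis by (simp only: of_real_eq_iff)
qed

lemma inn_cauchy_schwarz: "(cmod (inn n x y))\<^sup>2 \<le> nsq n x * nsq n y"
proof -
  have "cmod (inn n x y) \<le> (\<Sum>i<n. cmod (x i) * cmod (y i))"
    unfolding inn_def by (rule sum_norm_le) (simp add: norm_mult)
  then have "(cmod (inn n x y))\<^sup>2 \<le> (\<Sum>i<n. cmod (x i) * cmod (y i))\<^sup>2"
    by (simp add: power_mono)
  also have "\<dots> \<le> (L2_set (\<lambda>i. cmod (x i)) {..<n} * L2_set (\<lambda>i. cmod (y i)) {..<n})\<^sup>2"
    using L2_set_mult_ineq[of "\<lambda>i. cmod (x i)" "\<lambda>i. cmod (y i)" "{..<n}"]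
    by (intro power_mono) (auto intro: sum_nonneg)
  also have "\<dots> = nsq n x * nsq n y"
    by (simp add: L2_set_def nsq_def power_mult_distrib sum_nonneg)
  finally show ?thesis .
qed

section \<open>Operator norm bounds under adjoints, projections and masks\<close>

lemma opbound_kadj:
  assumes f: "opbound n c f"
  shows "opbound n c (kadj f)"
  unfolding opbound_def
proof
  fix x
  define y where "y = kapp n (kadj f) x"
  \<comment> \<open>Testing \<open>f\<close> on \<open>y\<close> itself: Cauchy-Schwarz and the
    bound for \<open>f\<close> then leave one factor \<open>nsq n y\<close> to cancel.\<close>
  have "of_real (nsq n y) = inn n (kapp n f y) x"
    by (simp add: y_def inn_self[symmetric] inn_kapp)
  then have "(cmod (of_real (nsq n y)))\<^sup>2 \<le> nsq n (kapp n f y) * nsq n x"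
    using inn_cauchy_schwarz[of n "kapp n f y" x] by simp
  also have "\<dots> \<le> (c * nsq n y) * nsq n x"
    using f by (intro mult_right_mono) (auto simp: opbound_def)
  finally have le: "nsq n y * nsq n y \<le> nsq n y * (c * nsq n x)"
    by (simp add: power2_eq_square mult_ac)
  have "nsq n y \<le> c * nsq n x"
  proof (cases "nsq n y = 0")
    case True
    show ?thesis
    proof (cases "nsq n x = 0")
      case False
      \<comment> \<open>\<open>c\<close> carries no sign condition; the sign of the product comes
        from the bound for \<open>f\<close> at \<open>x\<close>.\<close>
      have "0 \<le> c * nsq n x"
        using f order_trans[OF nsq_nonneg] unfolding opbound_def by blast
      with True show ?thesis by simp
    qed (use True in simp)
  next
    case False
    then have "0 < nsq n y" using nsq_nonneg[of n y] by linarith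
    then show ?thesis using le by simp
  qed
  then show "nsq n (kapp n (kadj f) x) \<le> c * nsq n x" by (simp add: y_def)
qed

lemma orthproj_pythagoras:
  assumes "orthproj n U"
  shows "nsq n x = nsq n (kapp n U x) + nsq n (x - kapp n U x)"
proof -
  have "kapp n U (x - kapp n U x) = kapp n U x - kapp n (kmul n U U) x"
    by (simp add: kapp_kmul) (simp add: kapp_def fun_eq_iff algebra_simps sum_subtractf)
  then have "kapp n U (x - kapp n U x) = 0"
    using assms by (simp add: orthproj_def)
  then have "inn n (kapp n U x) (x - kapp n U x) = 0"
    using assms by (simp add: inn_kapp orthproj_def)
  from nsq_add_orthogonal[OF this] show ?thesis by simp
qed

lemma opbound_mono: "opbound n a f \<Longrightarrow> a \<le> b \<Longrightarrow> opbound n b f"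
  unfolding opbound_def by (meson mult_right_mono nsq_nonneg order_trans)

lemma opbound_orthproj:
  assumes "orthproj n U" "opbound n c f"
  shows "opbound n c (kmul n U f)" "opbound n c (f - kmul n U f)"
proof -
  have *: "nsq n (kapp n f x) = nsq n (kapp n (kmul n U f) x) + nsq n (kapp n (f - kmul n U f) x)" for x
    using orthproj_pythagoras[OF assms(1), of "kapp n f x"] by (simp add: kapp_kmul kapp_simps)
  have "nsq n (kapp n f x) \<le> c * nsq n x" for x
    using assms(2) by (simp add: opbound_def)
  then show "opbound n c (kmul n U f)" "opbound n c (f - kmul n U f)"
    unfolding opbound_def by (smt (verit) * nsq_nonneg)+
qed

lemma opbound_orthproj_right:
  assumes "orthproj n U" "opbound n c f"
  shows "opbound n c (kmul n f U)" "opbound n c (f - kmul n f U)"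
  using opbound_orthproj[OF assms(1) opbound_kadj[OF assms(2)], THEN opbound_kadj] assms(1)
  by (simp_all add: orthproj_def)

text \<open>The values of \<open>g\<close> lie in the range of \<open>U\<close> and those of
  \<open>f\<close> in its kernel, so squared norms add. This takes the place of the triangle
  inequality and is the source of the square root in the final bound.\<close>

lemma opbound_add_orthogonal:
  assumes "orthproj n U" "opbound n a f" "kmul n U f = 0" "opbound n b g" "kmul n U g = g"
  shows "opbound n (a + b) (f + g)"
  unfolding opbound_def
proof
  fix x
  have "inn n (kapp n g x) (kapp n f x) = inn n (kapp n g x) (kapp n (kmul n U f) x)"
    using inn_kapp[of n U "kapp n g x" "kapp n f x"] assms(1,5)
    by (simp add: orthproj_def kapp_kmul[symmetric])
  then have "inn n (kapp n g x) (kapp n f x) = 0"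
    by (simp add: assms(3) kapp_simps)
  from nsq_add_orthogonal[OF this]
  have "nsq n (kapp n (f + g) x) = nsq n (kapp n f x) + nsq n (kapp n g x)"
    by (simp add: kapp_simps add.commute)
  also have "\<dots> \<le> a * nsq n x + b * nsq n x"
    using assms(2,4) by (intro add_mono) (auto simp: opbound_def)
  finally show "nsq n (kapp n (f + g) x) \<le> (a + b) * nsq n x"
    by (simp add: algebra_simps)
qed

lemma opbound_add_orthogonal_right:
  assumes "orthproj n V" "opbound n a f" "kmul n f V = 0" "opbound n b g" "kmul n g V = g"
  shows "opbound n (a + b) (f + g)"
proof -
  have "kmul n V (kadj f) = 0" "kmul n V (kadj g) = kadj g"
    using assms(1,3,5) by (metis kadj_simps(2,5) orthproj_def)+
  from opbound_add_orthogonal[OF assms(1) opbound_kadj[OF assms(2)] this(1) opbound_kadj[OF assms(4)] this(2)]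
  have "opbound n (a + b) (kadj (f + g))" by simp
  from opbound_kadj[OF this] show ?thesis by simp
qed

lemma kapp_rmask: "kapp n (rmask S f) x = (\<lambda>i. if i \<in> S then kapp n f x i else 0)"
  by (auto simp: kapp_def rmask_def)

lemma nsq_mask: "nsq n (\<lambda>i. if i \<in> S then x i else 0) = (\<Sum>i\<in>{..<n} \<inter> S. (cmod (x i))\<^sup>2)"
  unfolding nsq_def by (subst sum.inter_restrict) (auto intro!: sum.cong)

lemma opbound_rmask:
  assumes "opbound n c f"
  shows "opbound n c (rmask S f)"
proof -
  have "nsq n (kapp n (rmask S f) x) \<le> nsq n (kapp n f x)" for x
    unfolding kapp_rmask nsq_mask by (subst nsq_def) (auto intro!: sum_mono2)
  then show ?thesis using assms order_trans unfolding opbound_def by blast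
qed

text \<open>The parts of \<open>f x\<close> on different row blocks have disjoint supports, so their
  squared norms add.\<close>

lemma opbound_rows:
  assumes "finite P" "disjoint P" "\<Union>P = {..<n}"
    and "\<And>S. S \<in> P \<Longrightarrow> opbound n c (rmask S f)"
  shows "opbound n (real (card P) * c) f"
  unfolding opbound_def
proof
  fix x
  have fin: "\<forall>S\<in>P. finite S" using assms(3) by (metis Sup_upper finite_lessThan finite_subset)
  have "nsq n (kapp n f x) = (\<Sum>i\<in>\<Union>P. (cmod (kapp n f x i))\<^sup>2)"
    by (simp add: nsq_def assms(3))
  also have "\<dots> = (\<Sum>S\<in>P. \<Sum>i\<in>S. (cmod (kapp n f x i))\<^sup>2)"
    using fin assms(2) by (subst sum.Union_disjoint) (auto simp: disjoint_def)
  also have "\<dots> = (\<Sum>S\<in>P. nsq n (kapp n (rmask S f) x))"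
    unfolding kapp_rmask nsq_mask using assms(3) by (intro sum.cong) (auto intro!: sum.cong)
  also have "\<dots> \<le> (\<Sum>S\<in>P. c * nsq n x)"
    using assms(4) by (intro sum_mono) (auto simp: opbound_def)
  finally show "nsq n (kapp n f x) \<le> real (card P) * c * nsq n x" by simp
qed

text \<open>Gram-Schmidt on the first \<open>k\<close> columns of \<open>B\<close>. The
  factorization through \<open>B\<close> bounds the rank and lets the support of \<open>B\<close>,
  or its invariance under another projection, pass to \<open>\<pi>\<close>.\<close>

lemma orthproj_exists:
  fixes n k :: nat
  assumes "\<And>i r. n \<le> i \<Longrightarrow> B i r = 0"
  shows "\<exists>\<pi> W. orthproj n \<pi> \<and> \<pi> = kmul k B W \<and> (\<forall>r<k. \<forall>i. kmul n \<pi> B i r = B i r)"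
proof (induction k)
  case 0
  show ?case
    by (rule exI[of _ 0]) (auto simp: orthproj_def kmul_def kadj_def fun_eq_iff)
next
  case (Suc k)
  then obtain \<pi> W where \<pi>: "orthproj n \<pi>" "\<pi> = kmul k B W"
    and fix_B: "\<forall>r<k. \<forall>i. kmul n \<pi> B i r = B i r" by blast
  \<comment> \<open>The residual of the new column. It vanishes from \<open>n\<close> on by the
    support hypothesis, so \<open>nsq n c = 0\<close> forces all of \<open>c\<close> to
    vanish.\<close>
  define c where "c = (\<lambda>i. B i k - kmul n \<pi> B i k)"
  have supp: "c i = 0" if "n \<le> i" for i
    using that assms by (simp add: c_def kmul_def \<pi>(2))
  have [simp]: "kadj \<pi> = \<pi>" "kmul n \<pi> \<pi> = \<pi>" using \<pi>(1) by (auto simp: orthproj_def)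
  show ?case
  proof (cases "nsq n c = 0")
    case True
    then have "c i = 0" for i
      using supp by (cases "i < n") (auto simp: nsq_def sum_nonneg_eq_0_iff)
    then have "\<forall>r<Suc k. \<forall>i. kmul n \<pi> B i r = B i r"
      using fix_B by (auto simp: c_def less_Suc_eq)
    moreover have "\<pi> = kmul (Suc k) B (\<lambda>r j. if r < k then W r j else 0)"
      by (auto simp: \<pi>(2) kmul_def fun_eq_iff)
    ultimately show ?thesis using \<pi>(1) by blast
  next
    case False
    define N where "N = complex_of_real (nsq n c)"
    have N: "N \<noteq> 0" "cnj N = N" using False by (auto simp: N_def)
    \<comment> \<open>The projection onto the line spanned by \<open>c\<close>, which is orthogonal
      to the range of \<open>\<pi>\<close>.\<close>
    define P where "P = (\<lambda>i j. c i * cnj (c j) / N)"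
    have adjP [simp]: "kadj P = P" by (simp add: kadj_def P_def N mult.commute)
    have \<pi>c: "(\<Sum>j<n. \<pi> i j * c j) = 0" for i
    proof -
      have e: "(\<Sum>j<n. \<pi> i j * g j k) = kmul n \<pi> g i k" for g
        by (simp add: kmul_def)
      have "(\<Sum>j<n. \<pi> i j * c j) = kmul n \<pi> B i k - kmul n \<pi> (kmul n \<pi> B) i k"
        unfolding e[symmetric] c_def by (simp add: right_diff_distrib sum_subtractf)
      then show ?thesis by (simp add: kmul_assoc[symmetric])
    qed
    have \<pi>P: "kmul n \<pi> P = 0"
    proof (intro ext)
      fix i j
      have "kmul n \<pi> P i j = (\<Sum>l<n. \<pi> i l * c l) * (cnj (c j) / N)"
        by (simp add: kmul_def P_def sum_distrib_right sum_divide_distrib mult.assoc)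
      then show "kmul n \<pi> P i j = 0 i j" by (simp add: \<pi>c)
    qed
    have P\<pi>: "kmul n P \<pi> = 0" 
      by (rule kadj_eqD) (simp add: \<pi>P)
    have cc: "(\<Sum>l<n. cnj (c l) * c l) = N"
      unfolding N_def inn_self[symmetric] inn_def by (simp add: mult.commute)
    have PP: "kmul n P P = P"
    proof (intro ext)
      fix i j
      have "kmul n P P i j = (\<Sum>l<n. cnj (c l) * c l) * (c i * cnj (c j) / (N * N))"
        unfolding kmul_def P_def sum_distrib_right by (simp add: algebra_simps)
      then show "kmul n P P i j = P i j" using N by (simp add: P_def cc)
    qed
    have "orthproj n (\<pi> + P)"
      by (simp add: orthproj_def kmul_distribs \<pi>P P\<pi> PP)
    \<comment> \<open>\<open>c\<close> is column \<open>k\<close> of \<open>B\<close> minus a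
      combination of earlier columns; those coefficients become the correction of the old
      \<open>W\<close>.\<close>
    moreover have "\<pi> + P = kmul (Suc k) B (\<lambda>r j. if r < k
        then W r j - (\<Sum>l<n. W r l * B l k) * (cnj (c j) / N) else cnj (c j) / N)" (is "_ = kmul _ _ ?W")
    proof (intro ext)
      fix i j
      have distrib: "(b - (\<Sum>r<k. B i r * a r)) * z = b * z - (\<Sum>r<k. B i r * (a r * z))"
        for a and b z :: complex
        by (simp add: left_diff_distrib sum_distrib_right mult.assoc)
      have "kmul n \<pi> B i k = (\<Sum>r<k. B i r * (\<Sum>l<n. W r l * B l k))"
        by (simp add: \<pi>(2) kmul_assoc) (simp add: kmul_def)
      then have "P i j = (B i k - (\<Sum>r<k. B i r * (\<Sum>l<n. W r l * B l k))) * (cnj (c j) / N)"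
        by (simp add: P_def c_def)
      also have "\<dots> = B i k * (cnj (c j) / N)
          - (\<Sum>r<k. B i r * ((\<Sum>l<n. W r l * B l k) * (cnj (c j) / N)))"
        by (rule distrib)
      finally show "(\<pi> + P) i j = kmul (Suc k) B ?W i j"
        by (simp add: \<pi>(2) kmul_def right_diff_distrib sum_subtractf)
    qed
    moreover have "kmul n (\<pi> + P) B i r = B i r" if "r < Suc k" for i r
    proof (cases "r < k")
      case True
      have "kmul n P B i r = kmul n P (kmul n \<pi> B) i r"
        using fix_B True by (simp add: kmul_def[of n P])
      also have "\<dots> = 0" by (simp add: kmul_assoc[symmetric] P\<pi>)
      finally show ?thesis using fix_B True by (simp add: kmul_distribs)
    next
      case False
      with that have r: "r = k" by simp
      have "kmul n P B i k = (\<Sum>l<n. P i l * c l) + kmul n P (kmul n \<pi> B) i k"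
        unfolding kmul_def[of n P] by (simp add: c_def algebra_simps sum.distrib sum_subtractf)
      also have "kmul n P (kmul n \<pi> B) i k = 0" by (simp add: kmul_assoc[symmetric] P\<pi>)
      also have "(\<Sum>l<n. P i l * c l) = (\<Sum>l<n. cnj (c l) * c l) * (c i / N)"
        unfolding P_def sum_distrib_right by (simp add: algebra_simps)
      also have "\<dots> = c i" using N by (simp add: cc)
      finally show ?thesis by (simp add: r kmul_distribs c_def)
    qed
    ultimately show ?thesis by blast
  qed
qed

section \<open>Compression along a hierarchy of partitions\<close>

definition offd :: "nat set set \<Rightarrow> kernel \<Rightarrow> kernel" where
  "offd P f = (\<lambda>i j. if \<exists>S\<in>P. i \<in> S \<and> j \<in> S then 0 else f i j)"

text \<open>Block diagonality, stated through the support of \<open>U\<close>; it makes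
  \<open>U\<close> commute with the masks of \<open>P\<close> and with \<open>offd P\<close>, and
  the truncated identity satisfies it for every \<open>P\<close>.\<close>

definition compat :: "nat set set \<Rightarrow> kernel \<Rightarrow> bool" where
  "compat P U \<longleftrightarrow> (\<forall>i j. U i j \<noteq> 0 \<longrightarrow> (\<forall>S\<in>P. i \<in> S \<longleftrightarrow> j \<in> S))"

definition finer :: "nat set set \<Rightarrow> nat set set \<Rightarrow> bool" where
  "finer P Q \<longleftrightarrow> (\<forall>S\<in>P. \<exists>T\<in>Q. S \<subseteq> T)"

definition covers :: "nat \<Rightarrow> nat set set \<Rightarrow> bool" where
  "covers n P \<longleftrightarrow> finite P \<and> disjoint P \<and> \<Union>P = {..<n}"

section \<open>Off-diagonal parts and block diagonal kernels\<close>

lemma offd_simps [simp]: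
  "offd P (f + g) = offd P f + offd P g" "offd P (f - g) = offd P f - offd P g"
  "kadj (offd P f) = offd P (kadj f)"
  by (auto simp: offd_def fun_eq_iff kadj_def)

lemma compat_kadj: "compat P U \<Longrightarrow> compat P (kadj U)"
  by (auto simp: compat_def kadj_def)

lemma compat_masks: "compat P U \<Longrightarrow> S \<in> P \<Longrightarrow> cmask S U = rmask S U"
  by (auto simp: compat_def rmask_def cmask_def fun_eq_iff)

lemma offd_kmul:
  assumes "compat P U"
  shows "offd P (kmul n U f) = kmul n U (offd P f)"
proof (intro ext)
  fix i j
  have eq: "U i l * offd P f l j = (if \<exists>S\<in>P. i \<in> S \<and> j \<in> S then 0 else U i l * f l j)" for l
    using assms unfolding compat_def offd_def by (cases "U i l = 0") auto
  show "offd P (kmul n U f) i j = kmul n U (offd P f) i j"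
    unfolding kmul_def eq
    by (auto simp: offd_def intro!: sum.cong)
qed

lemma offd_kmul_right:
  assumes "compat P V"
  shows "offd P (kmul n f V) = kmul n (offd P f) V"
  by (rule kadj_eqD) (simp add: offd_kmul compat_kadj[OF assms])

lemma offd_offd:
  assumes "finer P Q"
  shows "offd Q (offd P f) = offd Q f"
proof (intro ext)
  fix i j
  have "\<exists>T\<in>Q. i \<in> T \<and> j \<in> T" if "\<exists>S\<in>P. i \<in> S \<and> j \<in> S"
    using assms that unfolding finer_def by (meson subsetD)
  then show "offd Q (offd P f) i j = offd Q f i j"
    unfolding offd_def by presburger
qed

lemma rmask_offd:
  assumes "disjoint P" "S \<in> P"
  shows "rmask S (offd P f) = rmask S (cmask (- S) f)"
  using assms unfolding disjoint_def rmask_def cmask_def offd_def fun_eq_iff by auto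

text \<open>The set of \<open>P\<close> holding \<open>i\<close> and \<open>j\<close> lies in one
  set of \<open>Q\<close>, and disjointness keeps both out of all others. Hence projections built at
  one level remain usable at the coarser ones.\<close>

lemma compat_coarser:
  assumes "\<And>i j. U i j \<noteq> 0 \<Longrightarrow> \<exists>S\<in>P. i \<in> S \<and> j \<in> S" "finer P Q" "disjoint Q"
  shows "compat Q U"
  unfolding compat_def
proof (intro allI impI ballI)
  fix i j T assume "U i j \<noteq> 0" "T \<in> Q"
  moreover obtain S R where "i \<in> S" "j \<in> S" "R \<in> Q" "S \<subseteq> R"
    using assms(1)[OF \<open>U i j \<noteq> 0\<close>] assms(2) unfolding finer_def by blast
  ultimately show "i \<in> T \<longleftrightarrow> j \<in> T"
    using assms(3) unfolding disjoint_def by blast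
qed

lemma rank_le_kmul: "rank_le k f \<Longrightarrow> rank_le k (kmul n f g)"
  unfolding rank_le_def by (metis kmul_assoc)

lemma rank_le_kadj: "rank_le k f \<Longrightarrow> rank_le k (kadj f)"
  unfolding rank_le_def by (metis kadj_simps(2))

text \<open>One side of the compression of a level; the other side is the same lemma for the
  adjoint. The approximants belong to \<open>A\<close>, but the blocks to be projected belong to
  \<open>X\<close>: since \<open>U\<close> and \<open>V\<close> are contractions and
  \<open>U\<close> commutes with the masks, \<open>U Z V\<close> restricted to the rows
  \<open>S\<close> is as good for \<open>X\<close>. Its columns lie in the range of
  \<open>U\<close>, hence so does the range of \<open>U'\<close>.\<close>

lemma row_projection:
  assumes P: "covers n P" and U: "orthproj n U" "compat P U" and V: "orthproj n V"
    and approx: "\<And>S. S \<in> P \<Longrightarrow>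
      \<exists>Z. rank_le k Z \<and> opbound n e (rmask S (cmask (- S) A) - Z)"
    and X: "X = kmul n U (kmul n (offd P A) V)"
  obtains U' where "orthproj n U'" "kmul n U U' = U'"
    "\<And>S. S \<in> P \<Longrightarrow> rank_le k (rmask S U')"
    "\<And>i j. U' i j \<noteq> 0 \<Longrightarrow> \<exists>S\<in>P. i \<in> S \<and> j \<in> S"
    "opbound n (real (card P) * e) (X - kmul n U' X)"
proof -
  have disj: "disjoint P" and fin: "finite P" and Un: "\<Union>P = {..<n}"
    using P by (auto simp: covers_def)
  have UU: "kmul n U U = U" using U by (simp add: orthproj_def)
  have "\<exists>\<pi>. orthproj n \<pi> \<and> rmask S \<pi> = \<pi> \<and> kmul n U \<pi> = \<pi> \<and> rank_le k \<pi>
      \<and> opbound n e (rmask S X - kmul n \<pi> (rmask S X))" if S: "S \<in> P" for S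
  proof -
    obtain B C where bnd: "opbound n e (rmask S (cmask (- S) A) - kmul k B C)"
      using approx[OF S] unfolding rank_le_def by blast
    define B' where "B' = rmask S (kmul n U B)"
    have UB: "kmul n U (rmask S f) = rmask S (kmul n U f)" for f
      by (simp add: kmul_rmask compat_masks[OF U(2) S] mask_kmul)
    have supp: "B' i r = 0" if "n \<le> i" for i r
    proof -
      have "S \<subseteq> {..<n}" using S Un by blast
      then show ?thesis using that by (auto simp: B'_def rmask_def)
    qed
    obtain \<pi> W where \<pi>: "orthproj n \<pi>" "\<pi> = kmul k B' W"
      "\<forall>r<k. \<forall>i. kmul n \<pi> B' i r = B' i r"
      using orthproj_exists[of n B' k] supp by blast
    have B': "rmask S B' = B'" "kmul n U B' = B'"
      by (simp_all add: B'_def UB kmul_assoc[symmetric] UU)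
    have "rmask S \<pi> = \<pi>" "kmul n U \<pi> = \<pi>" "rank_le k \<pi>"
      using B' by (auto simp: \<pi>(2) mask_kmul rank_le_def kmul_assoc[symmetric])
    moreover have "opbound n e (rmask S X - kmul n \<pi> (rmask S X))"
    proof -
      \<comment> \<open>The compressed approximant. Its columns are combinations of those of
        \<open>B'\<close>, so \<open>\<pi>\<close> fixes it and the error is
        \<open>1 - \<pi>\<close> applied to \<open>rmask S X - M\<close>.\<close>
      define M where "M = kmul n U (kmul n (rmask S (kmul k B C)) V)"
      have "M = kmul n (rmask S (kmul n U (kmul k B C))) V"
        by (simp add: M_def kmul_assoc[symmetric] UB)
      also have "\<dots> = kmul k B' (kmul n C V)"
        by (simp add: B'_def mask_kmul kmul_assoc)
      finally have "M = kmul k B' (kmul n C V)" .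
      \<comment> \<open>Only the first \<open>k\<close> columns of \<open>B'\<close> are known to be
        fixed by \<open>\<pi>\<close>, but \<open>kmul k\<close> reads no others.\<close>
      moreover have "kmul k (kmul n \<pi> B') f = kmul k B' f" for f
        using \<pi>(3) by (simp add: kmul_def[of k])
      ultimately have M: "kmul n \<pi> M = M" by (simp add: kmul_assoc[symmetric])
      have "rmask S X = kmul n U (kmul n (rmask S (cmask (- S) A)) V)"
        by (simp only: X UB[symmetric] mask_kmul(1)[of S n "offd P A"] rmask_offd[OF disj S, symmetric])
      then have "rmask S X - M
          = kmul n U (kmul n (rmask S (rmask S (cmask (- S) A) - kmul k B C)) V)"
        by (simp add: M_def mask_distribs kmul_distribs)
      then have "opbound n e (rmask S X - M)"
        using opbound_orthproj(1)[OF U(1) opbound_orthproj_right(1)[OF V opbound_rmask[OF bnd]]]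
        by simp
      from opbound_orthproj(2)[OF \<pi>(1) this] show ?thesis
        by (simp add: kmul_distribs M)
    qed
    ultimately show ?thesis using \<pi>(1) by blast
  qed
  then obtain \<pi> where \<pi>: "\<And>S. S \<in> P \<Longrightarrow> orthproj n (\<pi> S) \<and> rmask S (\<pi> S) = \<pi> S
      \<and> kmul n U (\<pi> S) = \<pi> S \<and> rank_le k (\<pi> S)
      \<and> opbound n e (rmask S X - kmul n (\<pi> S) (rmask S X))"
    by metis
  \<comment> \<open>Self-adjointness turns row support into column support, so the
    \<open>\<pi> S\<close> occupy disjoint diagonal blocks and their sum is again a
    projection.\<close>
  have c\<pi>: "cmask S (\<pi> S) = \<pi> S" if "S \<in> P" for S
    by (rule kadj_eqD) (use \<pi>[OF that] in \<open>simp add: orthproj_def\<close>)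
  define U' where "U' = (\<Sum>S\<in>P. \<pi> S)"
  have block: "\<exists>S\<in>P. i \<in> S \<and> j \<in> S" if nz: "U' i j \<noteq> 0" for i j
  proof -
    have "(\<Sum>S\<in>P. \<pi> S i j) \<noteq> 0"
      using nz by (simp add: U'_def sum_kernel_apply)
    then obtain S where S: "S \<in> P" "\<pi> S i j \<noteq> 0"
      by (rule sum.not_neutral_contains_not_neutral)
    have "rmask S (\<pi> S) i j \<noteq> 0" "cmask S (\<pi> S) i j \<noteq> 0"
      using S(2) \<pi>[OF S(1)] c\<pi>[OF S(1)] by simp_all
    then show ?thesis using S(1) by (auto simp: rmask_def cmask_def split: if_splits)
  qed
  have rU': "rmask S U' = \<pi> S" if S: "S \<in> P" for S
  proof (intro ext)
    fix i j
    show "rmask S U' i j = \<pi> S i j"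
    proof (cases "i \<in> S")
      case True
      have "\<pi> T i j = 0" if "T \<in> P - {S}" for T
      proof -
        have "i \<notin> T" using that True S disj by (auto simp: disjoint_def)
        moreover have "\<pi> T i j = rmask T (\<pi> T) i j" using \<pi> that by simp
        ultimately show ?thesis by (simp add: rmask_def)
      qed
      then have "U' i j = \<pi> S i j"
        unfolding U'_def sum_kernel_apply using fin S by (subst sum.remove[of P S]) auto
      then show ?thesis using True by (simp add: rmask_def)
    next
      case False
      have "\<pi> S i j = rmask S (\<pi> S) i j" using \<pi> S by simp
      then show ?thesis using False by (simp add: rmask_def)
    qed
  qed
  have \<pi>U': "kmul n (\<pi> S) f = kmul n (\<pi> S) (rmask S f)" if "S \<in> P" for S f
    using c\<pi>[OF that] by (simp add: kmul_rmask)
  have "kadj U' = U'"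
    using \<pi> by (simp add: U'_def kadj_sum orthproj_def)
  moreover have "kmul n U' U' = U'"
  proof -
    have "kmul n (\<pi> S) U' = \<pi> S" if "S \<in> P" for S
      using \<pi>U'[OF that, of U'] \<pi>[OF that] rU'[OF that] by (simp add: orthproj_def)
    then have "(\<Sum>S\<in>P. kmul n (\<pi> S) U') = U'"
      unfolding U'_def by (intro sum.cong) auto
    then show ?thesis
      using kmul_sum(1)[of n \<pi> P U'] unfolding U'_def[symmetric] by simp
  qed
  ultimately have "orthproj n U'" by (simp add: orthproj_def)
  moreover have "kmul n U U' = U'"
    using \<pi> by (simp add: U'_def kmul_sum)
  moreover have "rank_le k (rmask S U')" if "S \<in> P" for S
    using \<pi> that by (simp add: rU')
  moreover have "opbound n (real (card P) * e) (X - kmul n U' X)"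
  proof (rule opbound_rows[OF fin disj Un])
    fix S assume S: "S \<in> P"
    have "rmask S (X - kmul n U' X) = rmask S X - kmul n (\<pi> S) (rmask S X)"
      by (simp add: mask_distribs mask_kmul rU'[OF S]) (metis \<pi>U' S)
    then show "opbound n e (rmask S (X - kmul n U' X))" using \<pi>[OF S] by simp
  qed
  ultimately show ?thesis using that block by blast
qed

text \<open>The second condition is what later compressions need: they only shrink the range of U.\<close>
definition row_basis :: "nat \<Rightarrow> nat \<Rightarrow> kernel \<Rightarrow> kernel \<Rightarrow> nat set \<Rightarrow> bool" where
  "row_basis n k F U S \<longleftrightarrow> (\<exists>Q. rank_le k Q
     \<and> kmul n Q (rmask S (cmask (- S) F)) = rmask S (cmask (- S) F)
     \<and> kmul n Q (rmask S U) = rmask S U)"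

section \<open>Low rank of block rows through one compression step\<close>

lemma rmask_diff_offd:
  assumes "disjoint P" "T \<in> P" "S \<subseteq> T"
  shows "rmask S (F - offd P F) = cmask T (rmask S F)"
  using assms unfolding disjoint_def rmask_def cmask_def offd_def fun_eq_iff by auto

lemma cmask_commute: "cmask S (cmask T f) = cmask T (cmask S f)"
  by (auto simp: cmask_def fun_eq_iff)

text \<open>Block row \<open>S\<close> of the new matrix is the old one cut to the columns in
  \<open>T\<close>, plus rows of \<open>U' X\<close>. As the range of \<open>U'\<close> lies in that
  of \<open>U\<close>, the old \<open>Q\<close> fixes both parts.\<close>

lemma row_basis_step:
  assumes "row_basis n k F U S" "disjoint P" "T \<in> P" "S \<subseteq> T" "kmul n U U' = U'"
  shows "row_basis n k (F - offd P F + kmul n U' X) U' S"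
proof -
  obtain Q where Q: "rank_le k Q" "kmul n Q (rmask S (cmask (- S) F)) = rmask S (cmask (- S) F)"
    "kmul n Q (rmask S U) = rmask S U"
    using assms(1) by (auto simp: row_basis_def)
  have U': "kmul n Q (rmask S U') = rmask S U'"
    by (metis Q(3) assms(5) kmul_assoc mask_kmul(1))
  have "rmask S (cmask (- S) (F - offd P F + kmul n U' X))
      = cmask T (rmask S (cmask (- S) F)) + kmul n (rmask S U') (cmask (- S) X)" (is "?l = ?r")
    unfolding rmask_cmask mask_distribs(1) rmask_diff_offd[OF assms(2-4)]
    by (simp add: mask_distribs mask_kmul cmask_commute)
  moreover have "kmul n Q ?r = ?r"
    by (simp add: kmul_distribs mask_kmul(2)[symmetric] Q(2) kmul_assoc[symmetric] U')
  ultimately show ?thesis using Q(1) U' unfolding row_basis_def by auto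
qed

text \<open>The kept diagonal block contributes nothing outside the columns \<open>S\<close>, and
  the rest has the idempotent left factor \<open>rmask S U'\<close>, which serves as
  \<open>Q\<close>.\<close>

lemma row_basis_new:
  assumes "disjoint P" "S \<in> P" "orthproj n U'" "compat P U'" "rank_le k (rmask S U')"
  shows "row_basis n k (F - offd P F + kmul n U' X) U' S"
proof -
  have U': "kmul n (rmask S U') (rmask S U') = rmask S U'"
    using assms(3) compat_masks[OF assms(4,2)]
    by (metis kmul_rmask mask_idem(1) mask_kmul(1) orthproj_def)
  have "cmask (- S) (cmask S f) = 0" for f
    by (auto simp: cmask_def fun_eq_iff)
  then have "rmask S (cmask (- S) (F - offd P F + kmul n U' X)) = kmul n (rmask S U') (cmask (- S) X)"
    unfolding rmask_cmask mask_distribs(1) rmask_diff_offd[OF assms(1,2) subset_refl]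
    by (simp add: mask_distribs mask_kmul)
  then show ?thesis using U' assms(5) unfolding row_basis_def by (metis kmul_assoc)
qed

text \<open>F is the current compression of A, Qs the partitions still to be processed and Fs the
  clusters already treated; the last clause allows any error in the compressed space to be
  added at Pythagorean cost.\<close>
definition hss_inv ::
  "nat \<Rightarrow> nat \<Rightarrow> kernel \<Rightarrow> nat set set set \<Rightarrow> nat set set \<Rightarrow> kernel \<Rightarrow> kernel \<Rightarrow> kernel \<Rightarrow> real \<Rightarrow> bool"
  where
  "hss_inv n k A Qs Fs F U V c \<longleftrightarrow> orthproj n U \<and> orthproj n V
     \<and> (\<forall>Q\<in>Qs. compat Q U \<and> compat Q V \<and> offd Q F = kmul n U (kmul n (offd Q A) V))
     \<and> (\<forall>S\<in>Fs. row_basis n k F U S \<and> row_basis n k (kadj F) V S)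
     \<and> (\<forall>b E. kmul n U E = E \<longrightarrow> kmul n E V = E \<longrightarrow> opbound n b E
            \<longrightarrow> opbound n (c + b) (A - F + E))"

section \<open>Compression of one level and induction over the levels\<close>

definition approximable :: "nat \<Rightarrow> nat \<Rightarrow> real \<Rightarrow> kernel \<Rightarrow> nat set \<Rightarrow> bool" where
  "approximable n k e A S \<longleftrightarrow> (\<exists>Z. rank_le k Z \<and> opbound n e (rmask S (cmask (- S) A) - Z))"

text \<open>\<open>X - U' X\<close> is annihilated by \<open>U'\<close> on the left;
  \<open>Y\<close> is fixed by \<open>U'\<close> on the left and annihilated by \<open>V'\<close> on
  the right; a later error \<open>E\<close> is fixed by both. So their squared bounds add, and the
  sum, still fixed by \<open>U\<close> and \<open>V\<close>, enters the old invariant in the role of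
  \<open>E\<close>.\<close>

lemma hss_inv_step:
  assumes inv: "hss_inv n k A (insert P Qs) Fs F U V c"
    and P: "covers n P" and Qs: "\<And>Q. Q \<in> Qs \<Longrightarrow> finer P Q \<and> disjoint Q"
    and Fs: "\<And>S. S \<in> Fs \<Longrightarrow> \<exists>T\<in>P. S \<subseteq> T"
    and approx: "\<And>S. S \<in> P \<Longrightarrow> approximable n k e A S \<and> approximable n k e (kadj A) S"
  shows "\<exists>F' U' V'. hss_inv n k A Qs (Fs \<union> P) F' U' V' (c + 2 * real (card P) * e)"
proof -
  define X where "X = offd P F"
  have UV: "orthproj n U" "orthproj n V" "compat P U" "compat P V"
    and X: "X = kmul n U (kmul n (offd P A) V)"
    using inv by (auto simp: hss_inv_def X_def)
  have [simp]: "kadj U = U" "kadj V = V" "kmul n U U = U" "kmul n V V = V"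
    using UV by (auto simp: orthproj_def)
  have X': "kadj X = kmul n V (kmul n (offd P (kadj A)) U)"
    by (simp add: X kmul_assoc)
  have UX: "kmul n U X = X" "kmul n X V = X"
    by (simp_all add: X kmul_assoc[symmetric]) (simp add: kmul_assoc)
  obtain U' where U': "orthproj n U'" "kmul n U U' = U'"
    and rU': "\<And>S. S \<in> P \<Longrightarrow> rank_le k (rmask S U')"
    and bU': "\<And>i j. U' i j \<noteq> 0 \<Longrightarrow> \<exists>S\<in>P. i \<in> S \<and> j \<in> S"
    and eU': "opbound n (real (card P) * e) (X - kmul n U' X)"
    using row_projection[OF P UV(1,3,2) _ X] approx unfolding approximable_def by metis
  obtain V' where V': "orthproj n V'" "kmul n V V' = V'"
    and rV': "\<And>S. S \<in> P \<Longrightarrow> rank_le k (rmask S V')"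
    and bV': "\<And>i j. V' i j \<noteq> 0 \<Longrightarrow> \<exists>S\<in>P. i \<in> S \<and> j \<in> S"
    and eV': "opbound n (real (card P) * e) (kadj X - kmul n V' (kadj X))"
    using row_projection[OF P UV(2,4,1) _ X'] approx unfolding approximable_def by metis
  have [simp]: "kadj U' = U'" "kadj V' = V'" "kmul n U' U' = U'" "kmul n V' V' = V'"
    using U' V' by (auto simp: orthproj_def)
  have U'U: "kmul n U' U = U'" and V'V: "kmul n V' V = V'"
    by (rule kadj_eqD, simp add: U'(2) V'(2))+
  have disj: "disjoint P" using P by (simp add: covers_def)
  have "finer P P" by (auto simp: finer_def)
  then have cP: "compat P U'" "compat P V'"
    using compat_coarser[of _ P P] bU' bV' disj by blast+
  have cQ: "compat Q U'" "compat Q V'" if "Q \<in> Qs" for Q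
    using compat_coarser[of _ P Q] bU' bV' Qs[OF that] by blast+
  \<comment> \<open>The diagonal blocks of \<open>P\<close> stay untouched, which preserves the work
    of the finer levels inside them.\<close>
  define F' where "F' = F - X + kmul n U' (kmul n X V')"
  have F'_adj: "kadj F' = kadj F - offd P (kadj F) + kmul n V' (kmul n (kadj X) U')"
    by (simp add: F'_def X_def kmul_assoc)
  have off: "offd Q F' = kmul n U' (kmul n (offd Q A) V')" if Q: "Q \<in> Qs" for Q
  proof -
    \<comment> \<open>By refinement \<open>offd Q\<close> cannot tell \<open>X\<close> from
      \<open>F\<close>: the two cancel in \<open>F'\<close> and only the compressed part
      remains.\<close>
    have "offd Q X = offd Q F" using offd_offd Qs[OF Q] by (simp add: X_def)
    moreover have "offd Q F = kmul n U (kmul n (offd Q A) V)"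
      using inv Q by (auto simp: hss_inv_def)
    ultimately have "offd Q F' = kmul n U' (kmul n (kmul n U (kmul n (offd Q A) V)) V')"
      by (simp add: F'_def offd_kmul[OF cQ(1)[OF Q]] offd_kmul_right[OF cQ(2)[OF Q]])
    also have "\<dots> = kmul n (kmul n U' U) (kmul n (offd Q A) (kmul n V V'))"
      by (simp only: kmul_assoc)
    finally show ?thesis by (simp add: U'U V'(2))
  qed
  have basis: "row_basis n k F' U' S \<and> row_basis n k (kadj F') V' S" if "S \<in> Fs \<union> P" for S
  proof (cases "S \<in> P")
    case True
    show ?thesis
      unfolding F'_adj unfolding F'_def X_def
      using row_basis_new[OF disj True] U' V' cP rU' rV' True by blast
  next
    case False
    then have "S \<in> Fs" using that by blast
    moreover from Fs[OF this] obtain T where "T \<in> P" "S \<subseteq> T" by blast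
    ultimately show ?thesis
      unfolding F'_adj unfolding F'_def X_def
      using row_basis_step[OF _ disj] inv U'(2) V'(2) unfolding hss_inv_def by blast
  qed
  have "opbound n (c + 2 * real (card P) * e + b) (A - F' + E)"
    if E: "kmul n U' E = E" "kmul n E V' = E" "opbound n b E" for b E
  proof -
    define Y where "Y = kmul n U' (X - kmul n X V')"
    have "opbound n (real (card P) * e) Y"
      unfolding Y_def using opbound_orthproj(1)[OF U'(1)] opbound_kadj[OF eV'] by simp
    moreover have "kmul n Y V' = 0"
      by (simp add: Y_def kmul_assoc kmul_distribs)
    ultimately have Y: "opbound n (real (card P) * e + b) (Y + E)"
      using opbound_add_orthogonal_right[OF V'(1)] E by blast
    have "kmul n U' (X - kmul n U' X) = 0" "kmul n U' (Y + E) = Y + E"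
      by (simp_all add: kmul_distribs kmul_assoc[symmetric] Y_def E(1))
    from opbound_add_orthogonal[OF U'(1) eU' this(1) Y this(2)]
    have "opbound n (real (card P) * e + (real (card P) * e + b)) (X - kmul n U' X + (Y + E))" .
    moreover have "kmul n U (X - kmul n U' X + (Y + E)) = X - kmul n U' X + (Y + E)"
    proof -
      have "kmul n U E = E" by (metis E(1) U'(2) kmul_assoc)
      then show ?thesis
        by (simp add: kmul_distribs kmul_assoc[symmetric] Y_def UX U'(2))
    qed
    moreover have "kmul n (X - kmul n U' X + (Y + E)) V = X - kmul n U' X + (Y + E)"
    proof -
      have "kmul n E V = E" by (metis E(2) V'V kmul_assoc)
      then show ?thesis
        by (simp add: kmul_distribs kmul_assoc Y_def UX V'V)
    qed
    ultimately have "opbound n (c + (real (card P) * e + (real (card P) * e + b)))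
        (A - F + (X - kmul n U' X + (Y + E)))"
      using inv unfolding hss_inv_def by blast
    moreover have "A - F + (X - kmul n U' X + (Y + E)) = A - F' + E"
      by (simp add: F'_def Y_def kmul_distribs)
    moreover have "c + (real (card P) * e + (real (card P) * e + b)) = c + 2 * real (card P) * e + b"
      by simp
    ultimately show ?thesis by (simp only:)
  qed
  then have "hss_inv n k A Qs (Fs \<union> P) F' U' V' (c + 2 * real (card P) * e)"
    unfolding hss_inv_def using U' V' cQ off basis by blast
  then show ?thesis by blast
qed

lemma hss_inv_iterate:
  assumes "hss_inv n k A (set Ps) Fs F U V c" "sorted_wrt finer Ps"
    and "\<And>P. P \<in> set Ps \<Longrightarrow> covers n P"
    and "\<And>P S. P \<in> set Ps \<Longrightarrow> S \<in> Fs \<Longrightarrow> \<exists>T\<in>P. S \<subseteq> T"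
    and "\<And>P S. P \<in> set Ps \<Longrightarrow> S \<in> P \<Longrightarrow> approximable n k e A S \<and> approximable n k e (kadj A) S"
  shows "\<exists>F' U' V'. hss_inv n k A {} (Fs \<union> \<Union>(set Ps)) F' U' V'
    (c + (\<Sum>P\<leftarrow>Ps. 2 * real (card P) * e))"
  using assms
proof (induction Ps arbitrary: Fs F U V c)
  case Nil
  then show ?case by auto
next
  case (Cons P Ps)
  have ref: "finer P Q" if "Q \<in> set Ps" for Q
    using Cons.prems(2) that by simp
  have "finer P Q \<and> disjoint Q" if "Q \<in> set Ps" for Q
    using Cons.prems(3) ref that by (simp add: covers_def)
  then obtain F' U' V' where
    "hss_inv n k A (set Ps) (Fs \<union> P) F' U' V' (c + 2 * real (card P) * e)"
    using hss_inv_step[of n k A P "set Ps" Fs F U V c e] Cons.prems(1,3-5) by force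
  then have "\<exists>F' U' V'. hss_inv n k A {} ((Fs \<union> P) \<union> \<Union>(set Ps)) F' U' V'
      (c + 2 * real (card P) * e + (\<Sum>P\<leftarrow>Ps. 2 * real (card P) * e))"
  proof (rule Cons.IH)
    show "\<exists>T\<in>Q. S \<subseteq> T" if "Q \<in> set Ps" "S \<in> Fs \<union> P" for Q S
      using that ref Cons.prems(4) unfolding finer_def by (metis UnE list.set_intros(2))
    show "approximable n k e A S \<and> approximable n k e (kadj A) S" if "Q \<in> set Ps" "S \<in> Q" for Q S
      using that Cons.prems(5) by (meson list.set_intros(2))
  qed (use Cons.prems in auto)
  then show ?case by (simp add: Un_assoc add.assoc)
qed

lemma hierarchical_compression:
  assumes "sorted_wrt finer Ps" and "\<And>P. P \<in> set Ps \<Longrightarrow> covers n P"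
    and supp: "\<And>i j. A i j \<noteq> 0 \<Longrightarrow> i < n \<and> j < n"
    and "\<And>P S. P \<in> set Ps \<Longrightarrow> S \<in> P \<Longrightarrow> approximable n k e A S \<and> approximable n k e (kadj A) S"
  obtains F where "opbound n (\<Sum>P\<leftarrow>Ps. 2 * real (card P) * e) (A - F)"
    "\<And>P S. P \<in> set Ps \<Longrightarrow> S \<in> P \<Longrightarrow>
      rank_le k (rmask S (cmask (- S) F)) \<and> rank_le k (cmask S (rmask (- S) F))"
proof -
  \<comment> \<open>The start without compression: \<open>I A I = A\<close> holds exactly because
    \<open>A\<close> vanishes outside the indices below \<open>n\<close>.\<close>
  define I :: kernel where "I = (\<lambda>i j. if i = j \<and> i < n then 1 else 0)"
  have I: "kmul n I f = rmask {..<n} f" "kmul n f I = cmask {..<n} f" for f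
    by (auto simp: kmul_def I_def rmask_def cmask_def fun_eq_iff if_distrib if_distribR
        sum.delta cong: if_cong)
  have "orthproj n I"
    unfolding orthproj_def I by (auto simp: kadj_def rmask_def cmask_def I_def fun_eq_iff)
  moreover have "compat Q I" for Q
    by (simp add: compat_def I_def)
  moreover have "kmul n I (kmul n (offd Q A) I) = offd Q A" for Q
    unfolding I using supp by (auto simp: rmask_def cmask_def offd_def fun_eq_iff)
  ultimately have "hss_inv n k A (set Ps) {} A I I 0"
    by (simp add: hss_inv_def)
  then have "\<exists>F U V. hss_inv n k A {} ({} \<union> \<Union>(set Ps)) F U V
      (0 + (\<Sum>P\<leftarrow>Ps. 2 * real (card P) * e))"
    by (rule hss_inv_iterate[OF _ assms(1,2)]) (use assms(4) in auto)
  then obtain F U V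
    where inv: "hss_inv n k A {} (\<Union>(set Ps)) F U V (\<Sum>P\<leftarrow>Ps. 2 * real (card P) * e)"
    by auto
  have "opbound n 0 0"
    by (simp add: opbound_def kapp_simps nsq_def)
  then have "opbound n ((\<Sum>P\<leftarrow>Ps. 2 * real (card P) * e) + 0) (A - F + 0)"
    using inv kmul_zero unfolding hss_inv_def by blast
  then have "opbound n (\<Sum>P\<leftarrow>Ps. 2 * real (card P) * e) (A - F)" by simp
  moreover have "rank_le k (rmask S (cmask (- S) F)) \<and> rank_le k (cmask S (rmask (- S) F))"
    if S: "S \<in> \<Union>(set Ps)" for S
  proof -
    have "rank_le k (rmask S (cmask (- S) G))" if "row_basis n k G W S" for G W
      using that unfolding row_basis_def by (metis rank_le_kmul)
    then have "rank_le k (rmask S (cmask (- S) F))" "rank_le k (rmask S (cmask (- S) (kadj F)))"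
      using inv S unfolding hss_inv_def by blast+
    then show ?thesis using rank_le_kadj[of k "rmask S (cmask (- S) (kadj F))"] by simp
  qed
  ultimately show ?thesis using that by blast
qed

section \<open>Ranks, norms and blocks of matrices\<close>

text \<open>A maximal independent set of columns spans all columns and has at most \<open>k\<close>
  members. These form \<open>B\<close>; the coordinates of the columns form
  \<open>C\<close>.\<close>

lemma rank_factorization:
  fixes Z :: "complex mat"
  assumes Z: "Z \<in> carrier_mat m q" and rk: "vec_space.rank m Z \<le> k"
  obtains B C :: "nat \<Rightarrow> nat \<Rightarrow> complex"
    where "\<And>i j. i < m \<Longrightarrow> j < q \<Longrightarrow> Z $$ (i, j) = (\<Sum>r<k. B i r * C r j)"
proof -
  interpret vec_space "TYPE(complex)" m .
  let ?P = "\<lambda>T. T \<subseteq> set (cols Z) \<and> lin_indpt T"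
  have sub: "set (cols Z) \<subseteq> carrier_vec m"
    using cols_dim Z by blast
  obtain S where max: "maximal S ?P"
    using maximal_exists[of ?P "card (set (cols Z))" "{}"]
    by (meson List.finite_set card_mono empty_iff empty_subsetI finite_lin_indpt2 rev_finite_subset)
  then have S: "S \<subseteq> set (cols Z)" "lin_indpt S" by (auto simp: maximal_def)
  then have fin: "finite S" by (simp add: finite_subset)
  have "card S \<le> k" using rank_card_indpt[OF Z max] rk by simp
  have S_carrier: "S \<subseteq> carrier_vec m" using S(1) sub by blast
  have "\<exists>a. c = lincomb a S" if c: "c \<in> set (cols Z)" for c
  proof -
    have "c \<in> span S"
    proof (rule ccontr)
      assume nc: "c \<notin> span S"
      then have "c \<notin> S" using in_own_span[OF S_carrier[folded module_vec_simps]] by blast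
      moreover have "lin_indpt (S \<union> {c})"
        using lin_dep_iff_in_span[of S c] S(2) S_carrier c sub nc \<open>c \<notin> S\<close> by auto
      ultimately show False
        using max c S(1) unfolding maximal_def by blast
    qed
    then show ?thesis using finite_in_span[OF fin S_carrier] by blast
  qed
  then obtain a where a: "\<And>c. c \<in> set (cols Z) \<Longrightarrow> c = lincomb (a c) S" by metis
  obtain h where h: "bij_betw h {..<card S} S"
    using ex_bij_betw_nat_finite[OF fin] by (auto simp: atLeast0LessThan)
  \<comment> \<open>Padding by zero, since \<open>k\<close> may exceed the number of chosen
    columns.\<close>
  define B where "B = (\<lambda>i r. if r < card S then h r $ i else 0)"
  define C where "C = (\<lambda>r j. a (col Z j) (h r))"
  have "Z $$ (i, j) = (\<Sum>r<k. B i r * C r j)" if "i < m" "j < q" for i j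
  proof -
    have "col Z j \<in> set (cols Z)" using that Z by (metis carrier_matD(2) cols_length cols_nth nth_mem)
    then have "col Z j $ i = lincomb (a (col Z j)) S $ i" using a by metis
    also have "\<dots> = (\<Sum>x\<in>S. a (col Z j) x * x $ i)"
      by (rule lincomb_index[OF that(1) S_carrier])
    also have "\<dots> = (\<Sum>r<card S. B i r * C r j)"
      by (subst sum.reindex_bij_betw[OF h, symmetric]) (simp add: B_def C_def mult.commute)
    also have "\<dots> = (\<Sum>r<k. B i r * C r j)"
      using \<open>card S \<le> k\<close> by (intro sum.mono_neutral_left) (auto simp: B_def)
    finally show ?thesis using that Z by simp
  qed
  then show ?thesis by (rule that)
qed

text \<open>Outer products have rank at most one and rank is subadditive.\<close>

lemma rank_le_of_factorization:
  fixes Y :: "complex mat"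
  assumes "Y \<in> carrier_mat m q"
    and "\<And>i j. i < m \<Longrightarrow> j < q \<Longrightarrow> Y $$ (i, j) = (\<Sum>r<k. B i r * C r j)"
  shows "vec_space.rank m Y \<le> k"
  using assms
proof (induction k arbitrary: Y)
  case 0
  then have "Y = 0\<^sub>m m q" by (intro eq_matI) auto
  then show ?case by (simp add: vec_space.rank_0I)
next
  case (Suc k)
  define Y1 Y2 where "Y1 = mat m q (\<lambda>(i, j). \<Sum>r<k. B i r * C r j)"
    and "Y2 = mat m q (\<lambda>(i, j). B i k * C k j)"
  have "Y = Y1 + Y2" using Suc.prems by (intro eq_matI) (auto simp: Y1_def Y2_def)
  moreover have "vec_space.rank m Y1 \<le> k" by (rule Suc.IH) (auto simp: Y1_def)
  moreover have "vec_space.rank m Y2 \<le> 1"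
    by (rule vec_space.rank_le_1_product_entries[of _ _ q "\<lambda>i. B i k" "\<lambda>j. C k j"])
      (auto simp: Y2_def)
  moreover have "vec_space.rank m (Y1 + Y2) \<le> vec_space.rank m Y1 + vec_space.rank m Y2"
    by (rule vec_space.rank_subadditive[of _ _ q]) (auto simp: Y1_def Y2_def)
  ultimately show ?case by simp
qed

section \<open>Euclidean norm and spectral norm\<close>

lemma vnorm2_sq: "(vnorm2 v)\<^sup>2 = nsq (dim_vec v) (\<lambda>i. v $ i)"
  by (simp add: vnorm2_def nsq_def sum_nonneg)

lemma vnorm2_nonneg [simp]: "0 \<le> vnorm2 v"
  by (simp add: vnorm2_def sum_nonneg)

lemma vnorm2_smult: "vnorm2 (c \<cdot>\<^sub>v v) = cmod c * vnorm2 v"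
proof -
  have "(\<Sum>i<dim_vec v. (cmod ((c \<cdot>\<^sub>v v) $ i))\<^sup>2) = (cmod c)\<^sup>2 * (\<Sum>i<dim_vec v. (cmod (v $ i))\<^sup>2)"
    by (simp add: norm_mult power_mult_distrib sum_distrib_left)
  then show ?thesis by (simp add: vnorm2_def real_sqrt_mult)
qed

lemma mult_mat_vec_entry:
  assumes "M \<in> carrier_mat m q" "x \<in> carrier_vec q" "i < m"
  shows "(M *\<^sub>v x) $ i = (\<Sum>j<q. M $$ (i, j) * x $ j)"
  using assms by (auto simp: scalar_prod_def atLeast0LessThan intro!: sum.cong)

text \<open>Boundedness is what gives \<open>Sup\<close> its meaning over the reals.
  \<open>K\<close> is the squared Frobenius norm; Cauchy-Schwarz is used in each row.\<close>

lemma spec_norm_bdd: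
  assumes M: "M \<in> carrier_mat m q"
  shows "bdd_above {vnorm2 (M *\<^sub>v x) | x. x \<in> carrier_vec (dim_col M) \<and> vnorm2 x \<le> 1}"
proof -
  define K where "K = (\<Sum>i<m. nsq q (\<lambda>j. cnj (M $$ (i, j))))"
  have "vnorm2 (M *\<^sub>v x) \<le> sqrt K" if x: "x \<in> carrier_vec q" "vnorm2 x \<le> 1" for x
  proof -
    have nx: "nsq q (\<lambda>j. x $ j) \<le> 1"
      using x vnorm2_sq[of x] by (metis carrier_vecD power_le_one vnorm2_nonneg)
    have "(cmod ((M *\<^sub>v x) $ i))\<^sup>2 \<le> nsq q (\<lambda>j. cnj (M $$ (i, j)))" if "i < m" for i
    proof -
      have "(M *\<^sub>v x) $ i = inn q (\<lambda>j. x $ j) (\<lambda>j. cnj (M $$ (i, j)))"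
        using mult_mat_vec_entry[OF M x(1) that] by (simp add: inn_def mult.commute)
      also have "(cmod \<dots>)\<^sup>2 \<le> nsq q (\<lambda>j. x $ j) * nsq q (\<lambda>j. cnj (M $$ (i, j)))"
        by (rule inn_cauchy_schwarz)
      also have "\<dots> \<le> nsq q (\<lambda>j. cnj (M $$ (i, j)))"
        by (rule mult_left_le_one_le) (use nx in auto)
      finally show ?thesis .
    qed
    then have "nsq m (\<lambda>i. (M *\<^sub>v x) $ i) \<le> K"
      unfolding K_def by (subst nsq_def) (auto intro: sum_mono)
    then show ?thesis using M by (auto simp: vnorm2_def nsq_def)
  qed
  then show ?thesis using M by (intro bdd_aboveI[of _ "sqrt K"]) auto
qed

lemma vnorm2_mult_le_spec_norm:
  assumes M: "M \<in> carrier_mat m q" and x: "x \<in> carrier_vec q"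
  shows "vnorm2 (M *\<^sub>v x) \<le> spec_norm M * vnorm2 x"
proof (cases "vnorm2 x = 0")
  case True
  then have "nsq q (\<lambda>j. x $ j) = 0" using vnorm2_sq[of x] x by simp
  then have "\<And>j. j < q \<Longrightarrow> x $ j = 0" by (simp add: nsq_def sum_nonneg_eq_0_iff)
  then have "\<And>i. i < m \<Longrightarrow> (M *\<^sub>v x) $ i = 0"
    using mult_mat_vec_entry[OF M x] by simp
  then have "vnorm2 (M *\<^sub>v x) = 0" using M by (simp add: vnorm2_def)
  then show ?thesis using True by simp
next
  case False
  then have pos: "0 < vnorm2 x" using vnorm2_nonneg[of x] by linarith
  define c where "c = complex_of_real (1 / vnorm2 x)"
  have c: "cmod c = 1 / vnorm2 x" unfolding c_def norm_of_real using pos by simp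
  have "vnorm2 (c \<cdot>\<^sub>v x) \<le> 1" using pos by (simp add: vnorm2_smult c)
  then have "vnorm2 (M *\<^sub>v (c \<cdot>\<^sub>v x)) \<le> spec_norm M"
    unfolding spec_norm_def using M x by (intro cSup_upper spec_norm_bdd[OF M]) auto
  moreover have "M *\<^sub>v (c \<cdot>\<^sub>v x) = c \<cdot>\<^sub>v (M *\<^sub>v x)"
    using M x by (rule mult_mat_vec)
  ultimately show ?thesis using pos by (simp add: vnorm2_smult c divide_le_eq)
qed

lemma spec_norm_nonneg: "0 \<le> spec_norm M"
proof -
  have "vnorm2 (0\<^sub>v (dim_col M)) \<le> 1" by (simp add: vnorm2_def)
  then have "vnorm2 (M *\<^sub>v 0\<^sub>v (dim_col M))
      \<in> {vnorm2 (M *\<^sub>v x) | x. x \<in> carrier_vec (dim_col M) \<and> vnorm2 x \<le> 1}"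
    using zero_carrier_vec by blast
  then have "vnorm2 (M *\<^sub>v 0\<^sub>v (dim_col M)) \<le> spec_norm M"
    unfolding spec_norm_def
    by (intro cSup_upper spec_norm_bdd[of M "dim_row M" "dim_col M"]) auto
  then show ?thesis using vnorm2_nonneg order_trans by blast
qed

lemma spec_norm_le:
  assumes M: "M \<in> carrier_mat n n" and f: "opbound n c f"
    and Mf: "\<And>i j. i < n \<Longrightarrow> j < n \<Longrightarrow> M $$ (i, j) = f i j" and "0 \<le> c"
  shows "spec_norm M \<le> sqrt c"
  unfolding spec_norm_def
proof (rule cSup_least)
  have "vnorm2 (0\<^sub>v n) = 0" by (simp add: vnorm2_def)
  then show "{vnorm2 (M *\<^sub>v x) | x. x \<in> carrier_vec (dim_col M) \<and> vnorm2 x \<le> 1} \<noteq> {}"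
    using M by auto (metis zero_carrier_vec zero_le_one)
next
  fix y assume "y \<in> {vnorm2 (M *\<^sub>v x) | x. x \<in> carrier_vec (dim_col M) \<and> vnorm2 x \<le> 1}"
  then obtain x where x: "x \<in> carrier_vec n" "vnorm2 x \<le> 1" "y = vnorm2 (M *\<^sub>v x)"
    using M by auto
  have nx: "nsq n (\<lambda>j. x $ j) \<le> 1"
    using x vnorm2_sq[of x] by (metis carrier_vecD power_le_one vnorm2_nonneg)
  have "(M *\<^sub>v x) $ i = kapp n f (\<lambda>j. x $ j) i" if "i < n" for i
    using mult_mat_vec_entry[OF M x(1) that] Mf[OF that] by (simp add: kapp_def)
  then have "y\<^sup>2 = nsq n (kapp n f (\<lambda>j. x $ j))"
    using M by (simp add: x(3) vnorm2_sq nsq_def)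
  also have "\<dots> \<le> c * nsq n (\<lambda>j. x $ j)"
    using f by (simp add: opbound_def)
  also have "\<dots> \<le> c" using nx \<open>0 \<le> c\<close> by (simp add: mult_left_le)
  finally show "y \<le> sqrt c" by (rule real_le_rsqrt)
qed

section \<open>Passage between submatrices and masked kernels\<close>

definition ker_of :: "nat \<Rightarrow> complex mat \<Rightarrow> kernel" where
  "ker_of n A = (\<lambda>i j. if i < n \<and> j < n then A $$ (i, j) else 0)"

lemma bij_betw_pick:
  assumes "finite S"
  shows "bij_betw (pick S) {..<card S} S"
proof (rule bij_betwI')
  fix x y assume "x \<in> {..<card S}" "y \<in> {..<card S}"
  then show "(pick S x = pick S y) = (x = y)"
    using pick_mono_le[of x S y] pick_mono_le[of y S x] by (metis lessThan_iff less_irrefl linorder_neqE_nat)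
next
  fix x assume "x \<in> {..<card S}"
  then show "pick S x \<in> S" by (simp add: pick_in_set_le)
next
  fix y assume y: "y \<in> S"
  then have "card {a \<in> S. a < y} < card S"
    using assms by (intro psubset_card_mono) auto
  then show "\<exists>x\<in>{..<card S}. y = pick S x"
    using pick_card_in_set[OF y] by (metis lessThan_iff)
qed

lemma submatrix_carrier:
  assumes "A \<in> carrier_mat n n" "S \<subseteq> {..<n}" "T \<subseteq> {..<n}"
  shows "submatrix A S T \<in> carrier_mat (card S) (card T)"
    and "i < card S \<Longrightarrow> j < card T \<Longrightarrow> submatrix A S T $$ (i, j) = A $$ (pick S i, pick T j)"
proof -
  have "{i. i < n \<and> i \<in> S} = S" "{i. i < n \<and> i \<in> T} = T" using assms(2,3) by auto
  then show "submatrix A S T \<in> carrier_mat (card S) (card T)"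
    and "i < card S \<Longrightarrow> j < card T \<Longrightarrow> submatrix A S T $$ (i, j) = A $$ (pick S i, pick T j)"
    using assms(1) by (auto simp: submatrix_def)
qed

text \<open>\<open>W\<close> is \<open>Z\<close> written back into the rows \<open>S\<close> and
  columns \<open>T\<close>. Extension by zero costs nothing in norm: only the coordinates of
  \<open>x\<close> in \<open>T\<close> enter and only values at \<open>S\<close> come out.\<close>

lemma block_approx:
  assumes A: "A \<in> carrier_mat n n" and S: "S \<subseteq> {..<n}" and T: "T \<subseteq> {..<n}"
    and Z: "Z \<in> carrier_mat (card S) (card T)" "mrank Z \<le> k"
    and le: "spec_norm (submatrix A S T - Z) \<le> eps"
  shows "\<exists>W. rank_le k W \<and> opbound n (eps\<^sup>2) (rmask S (cmask T (ker_of n A)) - W)"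
proof -
  note Y = submatrix_carrier[OF A S T]
  have fin: "finite S" "finite T" using S T finite_subset by blast+
  define M where "M = submatrix A S T - Z"
  have M: "M \<in> carrier_mat (card S) (card T)" using Z(1) by (auto simp: M_def)
  obtain B C where BC: "\<And>i j. i < card S \<Longrightarrow> j < card T \<Longrightarrow> Z $$ (i, j) = (\<Sum>r<k. B i r * C r j)"
    using rank_factorization[OF Z(1)] Z(2) Z(1) unfolding mrank_def by (metis carrier_matD(1))
  \<comment> \<open>\<open>card {a \<in> S. a < i}\<close> is the position of \<open>i\<close> in
    \<open>S\<close>, inverse to \<open>pick S\<close>.\<close>
  define W where "W = kmul k (\<lambda>i r. if i \<in> S then B (card {a \<in> S. a < i}) r else 0)
    (\<lambda>r j. if j \<in> T then C r (card {b \<in> T. b < j}) else 0)"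
  define f where "f = rmask S (cmask T (ker_of n A)) - W"
  have f_out: "f i j = 0" if "i \<notin> S \<or> j \<notin> T" for i j
    using that by (auto simp: f_def W_def kmul_def rmask_def cmask_def)
  have f_in: "f (pick S a) (pick T b) = M $$ (a, b)" if "a < card S" "b < card T" for a b
  proof -
    have "pick S a \<in> S" "pick T b \<in> T" "card {i \<in> S. i < pick S a} = a" "card {i \<in> T. i < pick T b} = b"
      using that by (simp_all add: pick_in_set_le card_pick_le)
    moreover from this have "pick S a < n" "pick T b < n" using S T by auto
    ultimately show ?thesis
      using that Y(2)[OF that] Y(1) Z(1) BC[OF that]
      by (simp add: f_def W_def M_def kmul_def rmask_def cmask_def ker_of_def)
  qed
  have "opbound n (eps\<^sup>2) f"
    unfolding opbound_def
  proof
    fix x :: "nat \<Rightarrow> complex"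
    define y where "y = vec (card T) (\<lambda>b. x (pick T b))"
    have y: "y \<in> carrier_vec (card T)" by (simp add: y_def)
    have row: "kapp n f x (pick S a) = (M *\<^sub>v y) $ a" if a: "a < card S" for a
    proof -
      have "kapp n f x (pick S a) = (\<Sum>j\<in>T. f (pick S a) j * x j)"
        unfolding kapp_def using T f_out by (intro sum.mono_neutral_right) auto
      also have "\<dots> = (\<Sum>b<card T. f (pick S a) (pick T b) * x (pick T b))"
        by (rule sum.reindex_bij_betw[OF bij_betw_pick[OF fin(2)], symmetric])
      also have "\<dots> = (\<Sum>b<card T. M $$ (a, b) * y $ b)"
        using f_in[OF a] by (simp add: y_def)
      also have "\<dots> = (M *\<^sub>v y) $ a" by (rule mult_mat_vec_entry[OF M y a, symmetric])
      finally show ?thesis .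
    qed
    have "nsq n (kapp n f x) = (\<Sum>i\<in>S. (cmod (kapp n f x i))\<^sup>2)"
      unfolding nsq_def using S f_out by (intro sum.mono_neutral_right) (auto simp: kapp_def)
    also have "\<dots> = (\<Sum>a<card S. (cmod (kapp n f x (pick S a)))\<^sup>2)"
      by (rule sum.reindex_bij_betw[OF bij_betw_pick[OF fin(1)], symmetric])
    also have "\<dots> = (vnorm2 (M *\<^sub>v y))\<^sup>2"
      using M row by (simp add: vnorm2_sq nsq_def)
    also have "\<dots> \<le> (eps * vnorm2 y)\<^sup>2"
    proof (rule power_mono)
      have "spec_norm M * vnorm2 y \<le> eps * vnorm2 y"
        using le by (intro mult_right_mono) (auto simp: M_def)
      then show "vnorm2 (M *\<^sub>v y) \<le> eps * vnorm2 y"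
        using vnorm2_mult_le_spec_norm[OF M y] by linarith
    qed simp
    also have "\<dots> = eps\<^sup>2 * (\<Sum>b<card T. (cmod (x (pick T b)))\<^sup>2)"
      by (simp add: power_mult_distrib vnorm2_sq nsq_def y_def)
    also have "(\<Sum>b<card T. (cmod (x (pick T b)))\<^sup>2) = (\<Sum>j\<in>T. (cmod (x j))\<^sup>2)"
      by (rule sum.reindex_bij_betw[OF bij_betw_pick[OF fin(2)]])
    also have "eps\<^sup>2 * (\<Sum>j\<in>T. (cmod (x j))\<^sup>2) \<le> eps\<^sup>2 * nsq n x"
      unfolding nsq_def using T by (intro mult_left_mono sum_mono2) auto
    finally show "nsq n (kapp n f x) \<le> eps\<^sup>2 * nsq n x" .
  qed
  moreover have "rank_le k W" unfolding rank_le_def W_def by blast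
  ultimately show ?thesis unfolding f_def by blast
qed

lemma mrank_submatrix_le:
  assumes A: "A \<in> carrier_mat n n" and S: "S \<subseteq> {..<n}" and T: "T \<subseteq> {..<n}"
    and G: "rank_le k G" and AG: "\<And>i j. i \<in> S \<Longrightarrow> j \<in> T \<Longrightarrow> A $$ (i, j) = G i j"
  shows "mrank (submatrix A S T) \<le> k"
proof -
  note Y = submatrix_carrier[OF A S T]
  obtain B C where BC: "G = kmul k B C" using G by (auto simp: rank_le_def)
  have "vec_space.rank (card S) (submatrix A S T) \<le> k"
  proof (rule rank_le_of_factorization[OF Y(1)])
    fix i j assume "i < card S" "j < card T"
    then show "submatrix A S T $$ (i, j) = (\<Sum>r<k. B (pick S i) r * C r (pick T j))"
      using Y(2) AG by (simp add: pick_in_set_le BC kmul_def)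
  qed
  then show ?thesis using Y(1) by (simp add: mrank_def)
qed

text \<open>A node \<open>d\<close> steps above the leaves gathers \<open>2 ^ d\<close> consecutive
  leaves, and its two children are adjacent intervals.\<close>

lemma cnode_interval:
  assumes "1 \<le> i"
  shows "cnode ns d i = {sum_list (take ((i - 1) * 2 ^ d) ns) ..< sum_list (take (i * 2 ^ d) ns)}"
  using assms
proof (induction d arbitrary: i)
  case 0
  then show ?case by (simp add: leaf_def)
next
  case (Suc d)
  have mono: "sum_list (take a ns) \<le> sum_list (take b ns)" if "a \<le> b" for a b
    using that by (metis le_Suc_ex le_add1 sum_list_append take_add)
  obtain m where m: "i = Suc m" using Suc.prems by (cases i) auto
  have "cnode ns (Suc d) i
      = {sum_list (take (2 * m * 2 ^ d) ns) ..< sum_list (take ((2 * m + 1) * 2 ^ d) ns)}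
      \<union> {sum_list (take ((2 * m + 1) * 2 ^ d) ns) ..< sum_list (take ((2 * m + 2) * 2 ^ d) ns)}"
    using Suc.IH[of "2 * i - 1"] Suc.IH[of "2 * i"] by (simp add: m)
  also have "\<dots> = {sum_list (take (2 * m * 2 ^ d) ns) ..< sum_list (take ((2 * m + 2) * 2 ^ d) ns)}"
    by (rule ivl_disj_un_two(3)) (auto intro!: mono)
  finally show ?case by (simp add: m algebra_simps)
qed

section \<open>Cluster trees\<close>

text \<open>Indexed by the height above the leaves, as in \<open>cnode\<close>, so that increasing
  \<open>d\<close> is the order of compression; tree level \<open>l\<close> has height
  \<open>p - l\<close>.\<close>

definition level :: "nat list \<Rightarrow> nat \<Rightarrow> nat \<Rightarrow> nat set set" where
  "level ns p d = cnode ns d ` {1..2 ^ (p - d)}"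

lemma level_covers:
  assumes "length ns = 2 ^ p" "d \<le> p"
  shows "covers (sum_list ns) (level ns p d)"
proof -
  define g where "g = (\<lambda>i. sum_list (take (i * 2 ^ d) ns))"
  have mono: "g a \<le> g b" if "a \<le> b" for a b
    using that unfolding g_def
    by (metis le_Suc_ex le_add1 mult_le_mono1 sum_list_append take_add)
  have node: "cnode ns d i = {g (i - 1)..<g i}" if "1 \<le> i" for i
    using cnode_interval[OF that] by (simp add: g_def)
  have "(\<Union>i\<in>{1..N}. {g (i - 1)..<g i}) = {g 0..<g N}" for N
  proof (induction N)
    case (Suc N)
    have "(\<Union>i\<in>{1..Suc N}. {g (i - 1)..<g i}) = {g 0..<g N} \<union> {g N..<g (Suc N)}"
      using Suc.IH by (simp add: atLeastAtMostSuc_conv Un_commute)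
    also have "\<dots> = {g 0..<g (Suc N)}"
      by (rule ivl_disj_un_two(3)) (auto intro!: mono)
    finally show ?case .
  qed simp
  moreover have "g (2 ^ (p - d)) = sum_list ns"
    using assms by (simp add: g_def power_add[symmetric])
  ultimately have "\<Union>(level ns p d) = {..<sum_list ns}"
    using node by (simp add: level_def g_def atLeast0LessThan)
  moreover have "disjoint (level ns p d)"
  proof -
    have "cnode ns d i \<inter> cnode ns d j = {}" if "1 \<le> i" "i < j" for i j
    proof -
      have "g i \<le> g (j - 1)" using that by (intro mono) simp
      then show ?thesis using that by (simp add: node)
    qed
    then have disj: "cnode ns d i \<inter> cnode ns d j = {}" if "1 \<le> i" "1 \<le> j" "i \<noteq> j" for i j
      using that by (metis Int_commute linorder_neqE_nat)
    show ?thesis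
      unfolding disjoint_def
    proof (intro ballI impI)
      fix S T assume S: "S \<in> level ns p d" and T: "T \<in> level ns p d" and "S \<noteq> T"
      obtain i where "S = cnode ns d i" "1 \<le> i"
        using S by (auto simp: level_def)
      moreover obtain j where "T = cnode ns d j" "1 \<le> j"
        using T by (auto simp: level_def)
      ultimately show "S \<inter> T = {}" using disj \<open>S \<noteq> T\<close> by blast
    qed
  qed
  ultimately show ?thesis by (simp add: covers_def level_def)
qed

lemma finer_trans: "finer P Q \<Longrightarrow> finer Q R \<Longrightarrow> finer P R"
  unfolding finer_def by (meson order_trans)

lemma level_finer:
  assumes "d \<le> d'" "d' \<le> p"
  shows "finer (level ns p d) (level ns p d')"
  using assms
proof (induction d' rule: dec_induct)
  case base
  then show ?case by (auto simp: finer_def)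
next
  case (step d')
  have "finer (level ns p d') (level ns p (Suc d'))"
    unfolding finer_def
  proof
    fix S assume "S \<in> level ns p d'"
    then obtain i where i: "S = cnode ns d' i" "1 \<le> i" "i \<le> 2 ^ (p - d')"
      by (auto simp: level_def)
    \<comment> \<open>The parent of \<open>i\<close>, half of it rounded up, since \<open>j\<close>
      has children \<open>2 * j - 1\<close> and \<open>2 * j\<close>.\<close>
    define j where "j = (i + 1) div 2"
    have "i = 2 * j \<or> i = 2 * j - 1" "1 \<le> j" using i(2) by (auto simp: j_def)
    moreover have "j \<le> 2 ^ (p - Suc d')"
    proof -
      have "p - d' = Suc (p - Suc d')" using step.prems by simp
      then have "i \<le> 2 * 2 ^ (p - Suc d')" using i(3) by simp
      then show ?thesis by (simp add: j_def)
    qed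
    ultimately have "S \<subseteq> cnode ns (Suc d') j" "cnode ns (Suc d') j \<in> level ns p (Suc d')"
      by (auto simp: i(1) level_def)
    then show "\<exists>T\<in>level ns p (Suc d'). S \<subseteq> T" by blast
  qed
  then show ?case using step finer_trans by simp
qed

text \<open>Each of the \<open>2 ^ (p - d)\<close> nodes at height \<open>d\<close> has one block
  row and one block column; the root, at height \<open>p\<close>, has none.\<close>

lemma block_count: "(\<Sum>d<p. 2 * 2 ^ (p - d)) = (2 ^ (p + 2) - 4 :: real)"
  by (induction p) (simp_all add: sum.lessThan_Suc_shift del: sum.lessThan_Suc)

theorem theorem3:
  fixes ns :: "nat list" and p k n :: nat and eps :: real and A :: "complex mat"
  assumes "length ns = 2 ^ p"
    and "\<forall>m \<in> set ns. 0 < m"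
    and "n = sum_list ns"
    and "A \<in> carrier_mat n n"
    and "is_eps_HSS eps ns p k A"
  shows "\<exists>dA \<in> carrier_mat n n.
           spec_norm dA \<le> sqrt (2 ^ (p + 2) - 4) * eps \<and> is_HSS ns p k (A + dA)"
proof -
  define K where "K = ker_of n A"
  define Ps where "Ps = map (level ns p) [0..<p]"
  have cov: "covers n P" if "P \<in> set Ps" for P
    using that level_covers[OF assms(1)] assms(3) by (auto simp: Ps_def)
  have sub: "cluster ns p l i \<subseteq> {..<n}" and mem: "cluster ns p l i \<in> \<Union>(set Ps)"
    if "1 \<le> l" "l \<le> p" "1 \<le> i" "i \<le> 2 ^ l" for l i
  proof -
    have "level ns p (p - l) \<in> set Ps" using that by (auto simp: Ps_def)
    moreover have c: "cluster ns p l i \<in> level ns p (p - l)"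
      using that by (auto simp: level_def cluster_def)
    ultimately show "cluster ns p l i \<in> \<Union>(set Ps)" by blast
    then show "cluster ns p l i \<subseteq> {..<n}" using cov unfolding covers_def by blast
  qed
  \<comment> \<open>\<open>K\<close> vanishes outside the index range, so complements in the
    naturals and in \<open>{0..<n}\<close> cut out the same block.\<close>
  have K_compl: "cmask (- S) (rmask T K) = cmask ({0..<n} - S) (rmask T K)"
    "rmask (- S) (cmask T K) = rmask ({0..<n} - S) (cmask T K)" for S T
    by (auto simp: K_def ker_of_def rmask_def cmask_def fun_eq_iff)
  have approx: "approximable n k (eps\<^sup>2) K S \<and> approximable n k (eps\<^sup>2) (kadj K) S"
    if PS: "P \<in> set Ps" "S \<in> P" for P S
  proof -
    obtain d i where d: "d < p" "S = cnode ns d i" "1 \<le> i" "i \<le> 2 ^ (p - d)"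
      using PS by (auto simp: Ps_def level_def)
    define l where "l = p - d"
    have l: "1 \<le> l" "l \<le> p" "i \<le> 2 ^ l" and S: "S = cluster ns p l i"
      using d by (auto simp: l_def cluster_def)
    have Sn: "S \<subseteq> {..<n}" unfolding S by (rule sub) (use l d in auto)
    let ?T = "{0..<n} - S"
    have Tn: "?T \<subseteq> {..<n}" by auto
    have "hss_row A ns p l i \<in> hss_blocks A ns p" "hss_col A ns p l i \<in> hss_blocks A ns p"
      using l d(3) unfolding hss_blocks_def by blast+
    moreover have "hss_row A ns p l i = submatrix A S ?T" "hss_col A ns p l i = submatrix A ?T S"
      using assms(4) by (simp_all add: hss_row_def hss_col_def S)
    ultimately obtain Z1 Z2 where
      Z1: "Z1 \<in> carrier_mat (card S) (card ?T)" "mrank Z1 \<le> k" "spec_norm (submatrix A S ?T - Z1) \<le> eps" and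
      Z2: "Z2 \<in> carrier_mat (card ?T) (card S)" "mrank Z2 \<le> k" "spec_norm (submatrix A ?T S - Z2) \<le> eps"
      using assms(5) submatrix_carrier(1)[OF assms(4) Sn Tn] submatrix_carrier(1)[OF assms(4) Tn Sn]
      unfolding is_eps_HSS_def by (metis carrier_matD)
    obtain W1 where W1: "rank_le k W1" "opbound n (eps\<^sup>2) (rmask S (cmask ?T K) - W1)"
      using block_approx[OF assms(4) Sn Tn Z1] unfolding K_def by blast
    obtain W2 where W2: "rank_le k W2" "opbound n (eps\<^sup>2) (rmask ?T (cmask S K) - W2)"
      using block_approx[OF assms(4) Tn Sn Z2] unfolding K_def by blast
    have "approximable n k (eps\<^sup>2) K S"
      using W1 unfolding approximable_def rmask_cmask K_compl by blast
    \<comment> \<open>A block column of \<open>K\<close> is, up to adjoint, a block row of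
      \<open>kadj K\<close>, so the adjoint of \<open>W2\<close> is the required
      approximant.\<close>
    moreover have "rmask S (cmask (- S) (kadj K)) = kadj (rmask ?T (cmask S K))"
      unfolding K_compl(2)[symmetric] by (simp only: kadj_simps rmask_cmask)
    then have "opbound n (eps\<^sup>2) (rmask S (cmask (- S) (kadj K)) - kadj W2)"
      using opbound_kadj[OF W2(2)] by (simp only: kadj_simps(4))
    then have "approximable n k (eps\<^sup>2) (kadj K) S"
      using rank_le_kadj[OF W2(1)] unfolding approximable_def by blast
    ultimately show ?thesis by blast
  qed
  have "sorted_wrt finer Ps"
    unfolding Ps_def by (auto simp: sorted_wrt_iff_nth_less intro!: level_finer)
  moreover have "i < n \<and> j < n" if "K i j \<noteq> 0" for i j
    using that by (simp add: K_def ker_of_def split: if_splits)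
  ultimately obtain F where bnd: "opbound n (\<Sum>P\<leftarrow>Ps. 2 * real (card P) * eps\<^sup>2) (K - F)"
    and rk: "\<And>P S. P \<in> set Ps \<Longrightarrow> S \<in> P \<Longrightarrow>
      rank_le k (rmask S (cmask (- S) F)) \<and> rank_le k (cmask S (rmask (- S) F))"
    using hierarchical_compression[of Ps n K k "eps\<^sup>2"] cov approx by blast
  define dA where "dA = mat n n (\<lambda>(i, j). F i j - A $$ (i, j))"
  have dA: "dA \<in> carrier_mat n n" by (simp add: dA_def)
  define c where "c = (2 ^ (p + 2) - 4) * eps\<^sup>2"
  have "(2::real) ^ 2 \<le> 2 ^ (p + 2)" by (intro power_increasing) auto
  then have count: "(0::real) \<le> 2 ^ (p + 2) - 4" by simp
  have "(\<Sum>P\<leftarrow>Ps. 2 * real (card P) * eps\<^sup>2) = (\<Sum>d<p. 2 * real (card (level ns p d)) * eps\<^sup>2)"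
    by (simp add: Ps_def comp_def interv_sum_list_conv_sum_set_nat atLeast0LessThan)
  also have "\<dots> \<le> (\<Sum>d<p. 2 * 2 ^ (p - d) * eps\<^sup>2)"
  proof (intro sum_mono mult_right_mono mult_left_mono)
    fix d
    have "card (level ns p d) \<le> 2 ^ (p - d)"
      using card_image_le[of "{1..2 ^ (p - d)}" "cnode ns d"] by (simp add: level_def)
    then show "real (card (level ns p d)) \<le> 2 ^ (p - d)"
      by (metis of_nat_le_iff of_nat_numeral of_nat_power)
  qed auto
  also have "\<dots> = c"
    unfolding c_def block_count[symmetric] by (simp add: sum_distrib_right)
  finally have le_c: "(\<Sum>P\<leftarrow>Ps. 2 * real (card P) * eps\<^sup>2) \<le> c" .
  have "opbound n c (K - F)" by (rule opbound_mono[OF bnd le_c])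
  moreover have "kapp n (F - K) x = - kapp n (K - F) x" for x
    by (simp add: kapp_def fun_eq_iff sum_negf[symmetric] algebra_simps)
  ultimately have "opbound n c (F - K)" by (simp add: opbound_def nsq_def)
  then have "spec_norm dA \<le> sqrt c"
    by (rule spec_norm_le[OF dA]) (use count in \<open>auto simp: dA_def K_def ker_of_def c_def\<close>)
  also have "sqrt c = sqrt (2 ^ (p + 2) - 4) * eps"
  \<comment> \<open>\<open>sqrt (eps\<^sup>2)\<close> equals \<open>eps\<close> only if
    \<open>eps\<close> is nonnegative. For \<open>p > 0\<close> a block exists and its spectral norm
    bound forces this; for \<open>p = 0\<close> nothing constrains \<open>eps\<close>, but the
    factor \<open>2 ^ 2 - 4\<close> is zero.\<close>
  proof (cases "p = 0")
    case False
    have "0 \<le> eps"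
    proof -
      have "hss_row A ns p 1 1 \<in> hss_blocks A ns p"
        using False unfolding hss_blocks_def by fastforce
      then show ?thesis
        using assms(5) spec_norm_nonneg order_trans unfolding is_eps_HSS_def by blast
    qed
    then show ?thesis by (simp add: c_def real_sqrt_mult)
  qed (simp add: c_def)
  finally have "spec_norm dA \<le> sqrt (2 ^ (p + 2) - 4) * eps" .
  moreover have "is_HSS ns p k (A + dA)"
    unfolding is_HSS_def
  proof
    fix Y assume "Y \<in> hss_blocks (A + dA) ns p"
    then obtain l i where li: "1 \<le> l" "l \<le> p" "1 \<le> i" "i \<le> 2 ^ l"
      and Y: "Y = hss_row (A + dA) ns p l i \<or> Y = hss_col (A + dA) ns p l i"
      unfolding hss_blocks_def by blast
    define S where "S = cluster ns p l i"
    have S: "S \<subseteq> {..<n}" "{0..<n} - S \<subseteq> {..<n}" unfolding S_def using sub[OF li] by auto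
    have AdA: "A + dA \<in> carrier_mat n n" "\<And>i j. i < n \<Longrightarrow> j < n \<Longrightarrow> (A + dA) $$ (i, j) = F i j"
      using assms(4) dA by (auto simp: dA_def)
    have rks: "rank_le k (rmask S (cmask (- S) F))" "rank_le k (cmask S (rmask (- S) F))"
      using rk mem[OF li] unfolding S_def by blast+
    have "mrank (submatrix (A + dA) S ({0..<n} - S)) \<le> k"
      by (rule mrank_submatrix_le[OF AdA(1) S rks(1)])
        (use S AdA(2) in \<open>auto simp: rmask_def cmask_def subset_iff\<close>)
    moreover have "mrank (submatrix (A + dA) ({0..<n} - S) S) \<le> k"
      by (rule mrank_submatrix_le[OF AdA(1) S(2,1) rks(2)])
        (use S AdA(2) in \<open>auto simp: rmask_def cmask_def subset_iff\<close>)
    moreover have "dim_row (A + dA) = n" using dA by simp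
    ultimately show "mrank Y \<le> k"
      using Y by (auto simp: hss_row_def hss_col_def S_def)
  qed
  ultimately show ?thesis using dA by blast
qed

end
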